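(* Let $\mathcal{M}$ be a finite polycube translation $3$-manifold and let $\mathbf{v}=(\alpha_1,\alpha_2,1)$ be a Kronecker direction, i.e. $\alpha_1,\alpha_2,1$ are linearly independent over $\mathbb{Q}$. Then every non-empty open set $G\subset\mathcal{M}$ has positive visiting frequency relative to geodesic segments in direction $\mathbf{v}$; that is, there exist constants $\mathfrak{F}>0$ and $c>0$ (depending on $G$, $\mathcal{M}$ and $\mathbf{v}$) such that every geodesic segment $L$ in $\mathcal{M}$ with direction $\mathbf{v}$ and length $|L|\ge c$ satisfies $\lambda_1(G\cap L)\ge\mathfrak{F}|L|$, where $\lambda_1$ denotes $1$-dimensional Lebesgue measure.
   Context: A finite polycube region $M$ is a connected (not necessarily simply-connected) polyhedron in $\mathbb{R}^3$ tiled by finitely many closed unit cubes (atomic cubes), such that any two atomic cubes are disjoint, or meet at a single point, or share an edge, or share a face, and any two atomic cubes are joined by a chain of atomic cubes in which consecutive cubes share a face. A finite polycube translation $3$-manifold $\mathcal{M}$ is obtained from $M$ by identifying in pairs, by translation, the boundary faces with inward normals in opposite directions. Geodesics are straight lines in a fixed direction continued across identified faces; a geodesic segment is a finite piece of such a geodesic. *)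

theory Defs
  imports "HOL-Analysis.Analysis"
begin

definition ivec :: "int^3 \<Rightarrow> real^3" where
  "ivec c = (\<chi> j. real_of_int (c $ j))"

definition unit_e :: "3 \<Rightarrow> int^3" where
  "unit_e i = axis i 1"

definition atomic_cube :: "int^3 \<Rightarrow> (real^3) set" where
  "atomic_cube c = {x. \<forall>j. real_of_int (c $ j) \<le> x $ j \<and> x $ j \<le> real_of_int (c $ j) + 1}"

definition region :: "(int^3) set \<Rightarrow> (real^3) set" where
  "region C = \<Union> (atomic_cube ` C)"

definition face_adj :: "(int^3) set \<Rightarrow> int^3 \<Rightarrow> int^3 \<Rightarrow> bool" where
  "face_adj C c d \<longleftrightarrow> c \<in> C \<and> d \<in> C \<and> (\<exists>i. d = c + unit_e i \<or> d = c - unit_e i)"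

definition polycube_region :: "(int^3) set \<Rightarrow> bool" where
  "polycube_region C \<longleftrightarrow> finite C \<and> C \<noteq> {} \<and>
     (\<forall>c\<in>C. \<forall>d\<in>C. (face_adj C)\<^sup>*\<^sup>* c d)"

definition top_cubes :: "(int^3) set \<Rightarrow> 3 \<Rightarrow> (int^3) set" where
  "top_cubes C i = {a \<in> C. a + unit_e i \<notin> C}"

definition bot_cubes :: "(int^3) set \<Rightarrow> 3 \<Rightarrow> (int^3) set" where
  "bot_cubes C i = {b \<in> C. b - unit_e i \<notin> C}"

definition top_face :: "int^3 \<Rightarrow> 3 \<Rightarrow> (real^3) set" where
  "top_face a i = {x \<in> atomic_cube a. x $ i = real_of_int (a $ i) + 1}"

definition bot_face :: "int^3 \<Rightarrow> 3 \<Rightarrow> (real^3) set" where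
  "bot_face b i = {x \<in> atomic_cube b. x $ i = real_of_int (b $ i)}"

text \<open>A face pairing: for each direction i, a bijection sigma i matching each upper
  boundary face (of cube a) with a lower boundary face (of cube sigma i a); they are
  identified by the translation shift sigma i a.\<close>
definition face_pairing :: "(int^3) set \<Rightarrow> (3 \<Rightarrow> int^3 \<Rightarrow> int^3) \<Rightarrow> bool" where
  "face_pairing C \<sigma> \<longleftrightarrow> (\<forall>i. bij_betw (\<sigma> i) (top_cubes C i) (bot_cubes C i))"

definition shift :: "(3 \<Rightarrow> int^3 \<Rightarrow> int^3) \<Rightarrow> 3 \<Rightarrow> int^3 \<Rightarrow> real^3" where
  "shift \<sigma> i a = ivec (\<sigma> i a - a - unit_e i)"

text \<open>Subsets of the manifold are represented by their preimages in the region M,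
  i.e. subsets of M saturated under the face identifications.  Open sets of the
  quotient manifold are exactly the saturated, relatively open subsets of M.\<close>
definition saturated :: "(int^3) set \<Rightarrow> (3 \<Rightarrow> int^3 \<Rightarrow> int^3) \<Rightarrow> (real^3) set \<Rightarrow> bool" where
  "saturated C \<sigma> G \<longleftrightarrow>
     (\<forall>i. \<forall>a\<in>top_cubes C i. \<forall>x\<in>top_face a i. (x \<in> G \<longleftrightarrow> x + shift \<sigma> i a \<in> G))"

definition manifold_open :: "(int^3) set \<Rightarrow> (3 \<Rightarrow> int^3 \<Rightarrow> int^3) \<Rightarrow> (real^3) set \<Rightarrow> bool" where
  "manifold_open C \<sigma> G \<longleftrightarrow>
     G \<subseteq> region C \<and> openin (top_of_set (region C)) G \<and> saturated C \<sigma> G"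

text \<open>Transition of a geodesic at a point q (end of a straight piece) with unit
  direction u: either no jump, or q lies on a boundary face through which the
  geodesic exits, and it reappears at the identified point of the paired face.\<close>
definition geo_step :: "(int^3) set \<Rightarrow> (3 \<Rightarrow> int^3 \<Rightarrow> int^3) \<Rightarrow> real^3 \<Rightarrow> real^3 \<Rightarrow> real^3 \<Rightarrow> bool" where
  "geo_step C \<sigma> u q p \<longleftrightarrow> p = q \<or>
     (\<exists>i. \<exists>a\<in>top_cubes C i.
        (u $ i > 0 \<and> q \<in> top_face a i \<and> p = q + shift \<sigma> i a) \<or>
        (u $ i < 0 \<and> q \<in> bot_face (\<sigma> i a) i \<and> p = q - shift \<sigma> i a))"

definition unit_dir :: "real^3 \<Rightarrow> real^3" where
  "unit_dir v = (1 / norm v) *\<^sub>R v"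

text \<open>A geodesic segment in direction v is a nonempty list of straight pieces
  (start point p, length l), piece = {p + s u | 0 \<le> s \<le> l} with u = v/|v|,
  each contained in M, consecutive pieces glued by geo_step.\<close>
definition geodesic_segment ::
  "(int^3) set \<Rightarrow> (3 \<Rightarrow> int^3 \<Rightarrow> int^3) \<Rightarrow> real^3 \<Rightarrow> ((real^3) \<times> real) list \<Rightarrow> bool" where
  "geodesic_segment C \<sigma> v L \<longleftrightarrow> L \<noteq> [] \<and>
     (\<forall>(p, l) \<in> set L. 0 \<le> l \<and> (\<forall>s\<in>{0..l}. p + s *\<^sub>R unit_dir v \<in> region C)) \<and>
     (\<forall>j. Suc j < length L \<longrightarrow>
        geo_step C \<sigma> (unit_dir v)
          (fst (L ! j) + snd (L ! j) *\<^sub>R unit_dir v) (fst (L ! Suc j)))"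

definition seg_length :: "((real^3) \<times> real) list \<Rightarrow> real" where
  "seg_length L = sum_list (map snd L)"

definition visit_measure :: "real^3 \<Rightarrow> (real^3) set \<Rightarrow> ((real^3) \<times> real) list \<Rightarrow> real" where
  "visit_measure v G L =
     sum_list (map (\<lambda>(p, l). measure lborel {s \<in> {0..l}. p + s *\<^sub>R unit_dir v \<in> G}) L)"

definition kronecker_dir :: "real \<Rightarrow> real \<Rightarrow> bool" where
  "kronecker_dir \<alpha>1 \<alpha>2 \<longleftrightarrow>
     (\<forall>q1 q2 q3 :: rat. of_rat q1 * \<alpha>1 + of_rat q2 * \<alpha>2 + of_rat q3 = 0
        \<longrightarrow> q1 = 0 \<and> q2 = 0 \<and> q3 = 0)"

end

theory Submission
  imports Defs
begin

text \<open>
  Since every gluing translation is integral, a geodesic projects to a straight line in the torus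
  \<open>\<real>\<^sup>3 / \<int>\<^sup>3\<close>, and the manifold is a finite branched cover of this torus whose sheets are the
  cubes: crossing a face in direction i permutes the sheets. If arbitrarily long geodesics missed an
  open set, their sheet labels would accumulate, over each generic point of the torus, at a non-empty
  set of sheets. This set varies upper semicontinuously and is transported by the flow as long as the
  line meets no edge. By uniform density of Kronecker lines, it therefore has minimal size, and is
  locally constant, except on lines that meet an edge both in the past and in the future. A Kronecker
  line meets the edges of each direction at most once, so the exceptional lines meet edges of two
  different directions, and there are only countably many of them. Countably many lines do not
  disconnect a cube, so the set of sheets is the same over all generic points. It is then invariant
  under all the face permutations, and by connectedness it is the set of all sheets, including the
  one that contains the missed open set. This contradiction bounds the time between visits.
\<close>

section \<open>Cells and faces of the integer grid\<close>

text \<open>The obstacle is that a geodesic running into an edge may have no forced continuation, so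
  its label at one time need not determine its later labels. The argument therefore works with
  finite segments only and takes limits of sets of labels, never of orbits. Cardinality is the
  quantity to follow: every crossing of a face acts on the labels by a permutation, so the size of
  the limit set can change only at an edge, whatever the permutations are. No invariant measure
  enters. The frequency comes from a bounded gap between visits together with a fixed duration of
  each visit.\<close>

definition generic :: "real^3 \<Rightarrow> bool" where
  "generic x \<longleftrightarrow> (\<forall>i. x $ i \<notin> \<int>)"

definition fl :: "real^3 \<Rightarrow> int^3" where
  "fl x = (\<chi> i. \<lfloor>x $ i\<rfloor>)"

definition exit_vec :: "real^3 \<Rightarrow> 3 \<Rightarrow> int^3" where
  "exit_vec u i = axis i (if u $ i > 0 then 1 else - 1)"

lemma fl_nth [simp]: "fl x $ i = \<lfloor>x $ i\<rfloor>"
  by (simp add: fl_def)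

lemma ivec_nth [simp]: "ivec z $ i = of_int (z $ i)"
  by (simp add: ivec_def)

lemma ivec_add: "ivec (a + b) = ivec a + ivec b"
  by (simp add: vec_eq_iff)

lemma ivec_diff: "ivec (a - b) = ivec a - ivec b"
  by (simp add: vec_eq_iff)

lemma ivec_uminus: "ivec (- a) = - ivec a"
  by (simp add: vec_eq_iff)

lemma ivec_0 [simp]: "ivec 0 = 0"
  by (simp add: vec_eq_iff)

lemma fl_add_ivec [simp]: "fl (x + ivec z) = fl x + z"
  by (simp add: vec_eq_iff)

lemma Ints_add_of_int_iff: "x + of_int k \<in> \<int> \<longleftrightarrow> (x :: real) \<in> \<int>"
  by (metis Ints_add Ints_diff Ints_of_int add_diff_cancel_right')

lemma generic_add_ivec [simp]: "generic (x + ivec z) \<longleftrightarrow> generic x"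
  by (simp add: generic_def Ints_add_of_int_iff)

lemma not_Ints_iff_floor: "(x::real) \<notin> \<int> \<longleftrightarrow> of_int \<lfloor>x\<rfloor> < x"
  using of_int_floor_le[of x] by (auto simp: order_less_le elim: Ints_cases)

lemma generic_fl_iff:
  "generic x \<and> fl x = n \<longleftrightarrow> (\<forall>i. of_int (n $ i) < x $ i \<and> x $ i < of_int (n $ i) + 1)"
proof (intro iffI conjI allI)
  fix i assume "generic x \<and> fl x = n"
  then have "x $ i \<notin> \<int>" and [symmetric]: "\<lfloor>x $ i\<rfloor> = n $ i"
    by (auto simp: generic_def)
  then show "of_int (n $ i) < x $ i" and "x $ i < of_int (n $ i) + 1"
    by (auto simp: not_Ints_iff_floor)
next
  assume a: "\<forall>i. of_int (n $ i) < x $ i \<and> x $ i < of_int (n $ i) + 1"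
  then have *: "\<lfloor>x $ i\<rfloor> = n $ i" for i
    by (simp add: floor_eq_iff less_imp_le)
  then show "fl x = n"
    by (simp add: vec_eq_iff)
  show "generic x"
    using a * by (simp add: generic_def not_Ints_iff_floor)
qed

lemma cell_eq_box: "{x. generic x \<and> fl x = n} = box (ivec n) (ivec n + 1)"
  by (auto simp: generic_fl_iff mem_box_cart)

lemma open_cell: "open {x. generic x \<and> fl x = n}"
  unfolding cell_eq_box by (rule open_box)

lemma cell_ball:
  assumes "generic x"
  obtains e where "e > 0" "\<And>y. dist x y < e \<Longrightarrow> generic y \<and> fl y = fl x"
proof -
  have "x \<in> {y. generic y \<and> fl y = fl x}"
    using assms by simp
  then obtain e where "e > 0" "ball x e \<subseteq> {y. generic y \<and> fl y = fl x}"
    using open_cell open_contains_ball by blast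
  then show thesis
    by (intro that[of e]) auto
qed

section \<open>Floors along a line near one of its points\<close>

lemma eventually_floor_line:
  fixes a w :: real
  assumes "w \<noteq> 0"
  shows "\<forall>\<^sub>F s in nhds 0.
    \<lfloor>a + s * w\<rfloor> = (if a \<in> \<int> \<and> s * w < 0 then \<lfloor>a\<rfloor> - 1 else \<lfloor>a\<rfloor>) \<and>
    (s \<noteq> 0 \<or> a \<notin> \<int> \<longrightarrow> a + s * w \<notin> \<int>)"
proof (cases "a \<in> \<int>")
  case True
  then obtain k where k: "a = of_int k"
    by (auto elim: Ints_cases)
  have "open {s. \<bar>s * w\<bar> < 1}"
    by (intro open_Collect_less continuous_intros)
  then have "\<forall>\<^sub>F s in nhds 0. \<bar>s * w\<bar> < 1"
    by (auto simp: eventually_nhds)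
  then show ?thesis
  proof eventually_elim
    case (elim s)
    have 1: "\<lfloor>a + s * w\<rfloor> = (if s * w < 0 then k - 1 else k)"
      using elim by (auto simp: k floor_eq_iff)
    then have "of_int \<lfloor>a + s * w\<rfloor> < a + s * w" if "s \<noteq> 0"
      using elim that assms by (cases "s * w < 0") (auto simp: k order_less_le)
    then have "s \<noteq> 0 \<longrightarrow> a + s * w \<notin> \<int>"
      unfolding not_Ints_iff_floor by blast
    then show ?case
      using 1 True by (simp add: k)
  qed
next
  case False
  have "open ({s. of_int \<lfloor>a\<rfloor> < a + s * w} \<inter> {s. a + s * w < of_int \<lfloor>a\<rfloor> + 1})"
    by (intro open_Int open_Collect_less continuous_intros)
  moreover have "0 \<in> {s. of_int \<lfloor>a\<rfloor> < a + s * w} \<inter> {s. a + s * w < of_int \<lfloor>a\<rfloor> + 1}"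
    using False by (simp add: not_Ints_iff_floor)
  ultimately have "\<forall>\<^sub>F s in nhds 0. of_int \<lfloor>a\<rfloor> < a + s * w \<and> a + s * w < of_int \<lfloor>a\<rfloor> + 1"
    unfolding eventually_nhds by blast
  then show ?thesis
  proof eventually_elim
    case (elim s)
    then have "\<lfloor>a + s * w\<rfloor> = \<lfloor>a\<rfloor>"
      by (simp add: floor_eq_iff)
    then show ?case
      using elim False by (simp add: not_Ints_iff_floor)
  qed
qed

lemma floor_near_point:
  fixes q u :: "real^3"
  assumes "\<And>i. u $ i \<noteq> 0"
  obtains d where "d > 0"
    "\<And>s j. \<bar>s\<bar> < d \<Longrightarrow>
      \<lfloor>q $ j + s * u $ j\<rfloor> = (if q $ j \<in> \<int> \<and> s * u $ j < 0 then \<lfloor>q $ j\<rfloor> - 1 else \<lfloor>q $ j\<rfloor>)"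
    "\<And>s j. \<bar>s\<bar> < d \<Longrightarrow> s \<noteq> 0 \<or> q $ j \<notin> \<int> \<Longrightarrow> q $ j + s * u $ j \<notin> \<int>"
proof -
  have "\<forall>\<^sub>F s in nhds 0. \<forall>j. \<lfloor>q $ j + s * u $ j\<rfloor> =
      (if q $ j \<in> \<int> \<and> s * u $ j < 0 then \<lfloor>q $ j\<rfloor> - 1 else \<lfloor>q $ j\<rfloor>) \<and>
      (s \<noteq> 0 \<or> q $ j \<notin> \<int> \<longrightarrow> q $ j + s * u $ j \<notin> \<int>)"
    by (intro eventually_all_finite eventually_floor_line assms)
  then show thesis
    unfolding eventually_nhds_metric dist_real_def diff_0_right by (metis that)
qed

text \<open>The edges and vertices of the grid, over which alone the cover by sheets can branch.
  Away from them a line meets one face at a time.\<close>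

definition singular :: "real^3 \<Rightarrow> bool" where
  "singular q \<longleftrightarrow> (\<exists>i j. i \<noteq> j \<and> q $ i \<in> \<int> \<and> q $ j \<in> \<int>)"

lemma not_singularD: "\<not> singular q \<Longrightarrow> q $ i \<in> \<int> \<Longrightarrow> q $ j \<in> \<int> \<Longrightarrow> i = j"
  by (auto simp: singular_def)

lemma singular_add_ivec [simp]: "singular (x + ivec z) \<longleftrightarrow> singular x"
  by (simp add: singular_def Ints_add_of_int_iff)

lemma generic_not_singular: "generic x \<Longrightarrow> \<not> singular x"
  by (simp add: generic_def singular_def)

text \<open>Off the edges at most one coordinate of \<open>q\<close> is an integer, so at most one
  floor changes within the radius \<open>d\<close>, and only when \<open>s\<close> and
  \<open>t\<close> lie on opposite sides of 0. The two cells are thus in one of the two relations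
  that a trajectory controls.\<close>

lemma local_crossing:
  fixes q u :: "real^3"
  assumes u: "\<And>i. u $ i \<noteq> 0" and q: "\<not> singular q"
  obtains d where "d > 0"
    "\<And>s t. - d < s \<Longrightarrow> s \<le> t \<Longrightarrow> t < d \<Longrightarrow> generic (q + s *\<^sub>R u) \<Longrightarrow> generic (q + t *\<^sub>R u) \<Longrightarrow>
      fl (q + t *\<^sub>R u) = fl (q + s *\<^sub>R u) \<or>
      (\<exists>i. fl (q + t *\<^sub>R u) = fl (q + s *\<^sub>R u) + exit_vec u i)"
proof -
  obtain d where d: "d > 0"
    "\<And>s j. \<bar>s\<bar> < d \<Longrightarrow>
      \<lfloor>q $ j + s * u $ j\<rfloor> = (if q $ j \<in> \<int> \<and> s * u $ j < 0 then \<lfloor>q $ j\<rfloor> - 1 else \<lfloor>q $ j\<rfloor>)"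
    "\<And>s j. \<bar>s\<bar> < d \<Longrightarrow> s \<noteq> 0 \<or> q $ j \<notin> \<int> \<Longrightarrow> q $ j + s * u $ j \<notin> \<int>"
    by (rule floor_near_point[OF u, of q]) (rule that; assumption)
  show thesis
  proof (rule that[OF d(1)])
    fix s t assume st: "- d < s" "s \<le> t" "t < d" 
      and g: "generic (q + s *\<^sub>R u)" "generic (q + t *\<^sub>R u)"
    have "\<bar>s\<bar> < d" "\<bar>t\<bar> < d"
      using st by linarith+
    then have s: "\<lfloor>q $ j + s * u $ j\<rfloor> = (if q $ j \<in> \<int> \<and> s * u $ j < 0 then \<lfloor>q $ j\<rfloor> - 1 else \<lfloor>q $ j\<rfloor>)"
      and t: "\<lfloor>q $ j + t * u $ j\<rfloor> = (if q $ j \<in> \<int> \<and> t * u $ j < 0 then \<lfloor>q $ j\<rfloor> - 1 else \<lfloor>q $ j\<rfloor>)" for j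
      by (simp_all only: d(2))
    show "fl (q + t *\<^sub>R u) = fl (q + s *\<^sub>R u) \<or>
      (\<exists>i. fl (q + t *\<^sub>R u) = fl (q + s *\<^sub>R u) + exit_vec u i)"
    proof (cases "\<exists>i. q $ i \<in> \<int>")
      case False
      then show ?thesis
        by (simp add: vec_eq_iff s t)
    next
      case True
      then obtain i where i: "q $ i \<in> \<int>" by blast
      have ni: "q $ j \<notin> \<int>" if "j \<noteq> i" for j
        using not_singularD[OF q i] that by blast
      have "s \<noteq> 0" "t \<noteq> 0"
        using g i by (auto simp: generic_def)
      show ?thesis
      proof (cases "s < 0 \<and> 0 < t")
        case True
        then have "fl (q + t *\<^sub>R u) = fl (q + s *\<^sub>R u) + exit_vec u i"
          using ni i u[of i] by (auto simp: vec_eq_iff s t exit_vec_def axis_def mult_less_0_iff)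
        then show ?thesis by blast
      next
        case False
        then have "(s * u $ j < 0) = (t * u $ j < 0)" for j
          using \<open>s \<noteq> 0\<close> \<open>t \<noteq> 0\<close> st by (auto simp: mult_less_0_iff)
        then show ?thesis
          by (simp add: vec_eq_iff s t)
      qed
    qed
  qed
qed

text \<open>Unlike in \<open>local_crossing\<close>, the direction of the face is prescribed; this
  serves to compare the label sets on both sides of a face of each direction.\<close>

lemma face_crossing:
  fixes q u :: "real^3"
  assumes u: "\<And>i. u $ i \<noteq> 0" and i: "q $ i \<in> \<int>" and ni: "\<And>j. j \<noteq> i \<Longrightarrow> q $ j \<notin> \<int>"
  obtains s where "s > 0" "generic (q - s *\<^sub>R u)" "generic (q + s *\<^sub>R u)"
    "fl (q + s *\<^sub>R u) = fl (q - s *\<^sub>R u) + exit_vec u i"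
proof -
  obtain d where d: "d > 0"
    "\<And>s j. \<bar>s\<bar> < d \<Longrightarrow>
      \<lfloor>q $ j + s * u $ j\<rfloor> = (if q $ j \<in> \<int> \<and> s * u $ j < 0 then \<lfloor>q $ j\<rfloor> - 1 else \<lfloor>q $ j\<rfloor>)"
    "\<And>s j. \<bar>s\<bar> < d \<Longrightarrow> s \<noteq> 0 \<or> q $ j \<notin> \<int> \<Longrightarrow> q $ j + s * u $ j \<notin> \<int>"
    by (rule floor_near_point[OF u, of q]) (rule that; assumption)
  define s where "s = d / 2"
  have s: "s > 0" "\<bar>s\<bar> < d" "\<bar>- s\<bar> < d"
    using d(1) by (auto simp: s_def)
  show thesis
  proof (rule that[OF s(1)])
    show "generic (q - s *\<^sub>R u)" "generic (q + s *\<^sub>R u)"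
      using d(3)[OF s(3)] d(3)[OF s(2)] s by (auto simp: generic_def)
    show "fl (q + s *\<^sub>R u) = fl (q - s *\<^sub>R u) + exit_vec u i"
      using d(2)[OF s(3)] d(2)[OF s(2)] ni i u[of i] s(1)
      by (auto simp: vec_eq_iff exit_vec_def axis_def mult_less_0_iff zero_less_mult_iff)
  qed
qed

section \<open>Kronecker flow with finitely many sheets\<close>

lemma generic_near_point:
  fixes q u :: "real^3"
  assumes "\<And>i. u $ i \<noteq> 0"
  obtains d where "d > 0" "\<And>s. \<bar>s\<bar> < d \<Longrightarrow> s \<noteq> 0 \<Longrightarrow> generic (q + s *\<^sub>R u)"
proof -
  obtain d where d: "d > 0"
    "\<And>s j. \<bar>s\<bar> < d \<Longrightarrow>
      \<lfloor>q $ j + s * u $ j\<rfloor> = (if q $ j \<in> \<int> \<and> s * u $ j < 0 then \<lfloor>q $ j\<rfloor> - 1 else \<lfloor>q $ j\<rfloor>)"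
    "\<And>s j. \<bar>s\<bar> < d \<Longrightarrow> s \<noteq> 0 \<or> q $ j \<notin> \<int> \<Longrightarrow> q $ j + s * u $ j \<notin> \<int>"
    by (rule floor_near_point[OF assms, of q]) (rule that; assumption)
  then show thesis
    by (intro that[of d]) (auto simp: generic_def)
qed

text \<open>For the integer coordinates of two edges met by one line: the shared direction
  synchronises the two times, and the covering then reaches all coordinates.\<close>

lemma three_cover:
  fixes i j i' j' k :: 3
  assumes "i \<noteq> j" "i' \<noteq> j'" "{i, j} \<noteq> {i', j'}"
  shows "k \<in> {i, j, i', j'} \<and> {i, j} \<inter> {i', j'} \<noteq> {}"
proof -
  have 2: "card {i, j} = 2" "card {i', j'} = 2"
    using assms by simp_all
  have "{i, j} \<subset> {i, j} \<union> {i', j'}"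
    using card_subset_eq[of "{i, j}" "{i', j'}"] 2 assms(3) by auto
  then have "2 < card ({i, j} \<union> {i', j'})"
    using psubset_card_mono[of "{i, j} \<union> {i', j'}" "{i, j}"] 2 by simp
  then have 3: "card ({i, j} \<union> {i', j'}) = 3"
    using card_mono[of "UNIV :: 3 set" "{i, j} \<union> {i', j'}"] by simp
  then have "{i, j} \<union> {i', j'} = UNIV"
    by (intro card_subset_eq) simp_all
  moreover have "{i, j} \<inter> {i', j'} \<noteq> {}"
    using card_Un_disjoint[of "{i, j}" "{i', j'}"] 2 3 by auto
  ultimately show ?thesis
    by blast
qed

text \<open>What remains of the manifold is a finite set of sheets, the permutation
  \<open>R i\<close> for crossing a face in direction \<open>i\<close>, and connectedness in the
  form \<open>transitive\<close>. The \<open>R i\<close> may fail to commute: a loop around an edge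
  can permute the sheets, which is why edges need separate care.\<close>

locale cell_flow =
  fixes C :: "'c set" and R :: "3 \<Rightarrow> 'c \<Rightarrow> 'c" and u :: "real^3"
  assumes finite_C: "finite C"
    and bij_R: "bij_betw (R i) C C"
    and transitive: "D \<subseteq> C \<Longrightarrow> D \<noteq> {} \<Longrightarrow> (\<And>i. R i ` D = D) \<Longrightarrow> D = C"
    and kronecker: "(\<Sum>i\<in>UNIV. of_int (z $ i) * u $ i) = 0 \<Longrightarrow> z = 0"
begin

section \<open>Rational independence and density of lines in the torus\<close>

lemma integer_relation:
  assumes "i \<noteq> j" "of_int a * u $ i + of_int b * u $ j = 0"
  shows "a = 0 \<and> b = 0"
proof -
  have "of_int ((axis i a + axis j b) $ k) * u $ k =
      (if k = i then of_int a * u $ i else 0) + (if k = j then of_int b * u $ j else 0)" for k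
    by (auto simp: axis_def distrib_right)
  then have "(\<Sum>k\<in>UNIV. of_int ((axis i a + axis j b) $ k) * u $ k) =
      of_int a * u $ i + of_int b * u $ j"
    by (simp only: sum.distrib) (simp add: sum.delta)
  then have "axis i a + axis j b = 0"
    using assms kronecker by simp
  then have "(axis i a + axis j b) $ i = 0" "(axis i a + axis j b) $ j = 0"
    by simp_all
  then show ?thesis
    using assms(1) by (simp add: axis_def)
qed

lemma u_nonzero: "u $ i \<noteq> 0"
proof
  assume "u $ i = 0"
  moreover obtain j where "j \<noteq> i"
    by (rule that[of "i + 1"]) simp
  ultimately show False
    using integer_relation[of i j 1 0] by simp
qed

lemma dense_orbit:
  assumes "e > 0"
  obtains t z where "dist (t *\<^sub>R u) (y + ivec z) < e"
proof -
  \<comment> \<open>Independence is linear independence in the reals as a module over the integers,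
    the form used by Kronecker's approximation theorem.\<close>
  interpret Modules.module "(\<lambda>r. (*) (real_of_int r))"
    by unfold_locales (simp_all add: algebra_simps)
  \<comment> \<open>Kronecker's theorem is indexed by numbers below 3, hence an enumeration of the
    coordinates.\<close>
  define ix :: "nat \<Rightarrow> 3" where "ix = (\<lambda>k. if k = 0 then 1 else if k = 1 then 2 else 3)"
  have "{..<3} = {0, 1, 2 :: nat}"
    by auto
  moreover have "ix 0 = 1" "ix 1 = 2" "ix 2 = 3"
    by (simp_all add: ix_def)
  ultimately have ix: "ix ` {..<3} = UNIV"
    by (simp only: image_insert image_empty UNIV_3)
  then have inj_ix: "inj_on ix {..<3}"
    by (intro eq_card_imp_inj_on) simp_all
  have inj: "inj (\<lambda>i. u $ i)"
  proof (rule injI, rule ccontr)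
    fix i j assume "u $ i = u $ j" "i \<noteq> j"
    then show False
      using integer_relation[of i j 1 "- 1"] by simp
  qed
  have "f (u $ i) = 0" if "(\<Sum>x\<in>range (\<lambda>i. u $ i). real_of_int (f x) * x) = 0" for f i
  proof -
    have "(\<chi> i. f (u $ i)) = (0 :: int^3)"
      using that by (intro kronecker) (simp add: sum.reindex[OF inj] o_def)
    then show ?thesis
      by (simp add: vec_eq_iff)
  qed
  then have ind: "independent (range (\<lambda>i. u $ i))"
    by (subst dependent_finite) auto
  have 1: "independent ((\<lambda>k. u $ ix k) ` {..<3})"
    using ind ix by (metis image_image)
  have 2: "inj_on (\<lambda>k. u $ ix k) {..<3}"
    using inj_ix inj by (auto simp: inj_on_def)
  obtain t h where th: "\<And>k. k < 3 \<Longrightarrow> \<bar>t * u $ ix k - of_int (h k) - y $ ix k\<bar> < e / 3"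
    using Kronecker_thm_1[OF 1 2, of "e / 3" "\<lambda>k. y $ ix k"] assms by auto
  define z :: "int^3" where "z = (\<chi> j. h (inv_into {..<3} ix j))"
  have *: "\<bar>(t *\<^sub>R u - (y + ivec z)) $ j\<bar> < e / 3" for j
  proof -
    define k where "k = inv_into {..<3} ix j"
    have "k < 3" "ix k = j"
      using ix inv_into_into[of j ix "{..<3}"] f_inv_into_f[of j ix "{..<3}"]
      by (auto simp: k_def)
    then show ?thesis
      using th[of k] by (simp add: z_def k_def algebra_simps)
  qed
  have "norm (t *\<^sub>R u - (y + ivec z)) \<le> (\<Sum>j\<in>UNIV. \<bar>(t *\<^sub>R u - (y + ivec z)) $ j\<bar>)"
    by (rule norm_le_l1_cart)
  also have "\<dots> < (\<Sum>j\<in>(UNIV::3 set). e / 3)"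
    using * by (intro sum_strict_mono) auto
  finally show thesis
    by (intro that[of t z]) (simp add: dist_norm)
qed

text \<open>Compactness of the unit cube reduces all targets to a finite net, so only finitely many
  hitting times occur and they have a common bound. Translating the target by \<open>x\<close> makes
  the bound independent of the starting point.\<close>

lemma uniform_density:
  assumes "e > 0"
  obtains T where "T > 0" "\<And>x y. \<exists>s z. 0 \<le> s \<and> s \<le> T \<and> dist (x + s *\<^sub>R u) (y + ivec z) < e"
proof -
  have "e / 2 > 0"
    using assms by simp
  moreover have "\<forall>r>0. \<exists>W. finite W \<and> cbox 0 (1 :: real^3) \<subseteq> (\<Union>w\<in>W. ball w r)"
    using compact_cbox[of 0 "1 :: real^3"] unfolding compact_eq_totally_bounded by blast
  ultimately obtain W where W: "finite W" "cbox 0 (1 :: real^3) \<subseteq> (\<Union>w\<in>W. ball w (e / 2))"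
    by metis
  have "\<forall>w. \<exists>t z. dist (t *\<^sub>R u) (w + ivec z) < e / 2"
    using dense_orbit[of "e / 2"] assms by (metis half_gt_zero)
  then obtain t z where tz: "\<And>w. dist (t w *\<^sub>R u) (w + ivec (z w)) < e / 2"
    by metis
  define B where "B = (\<Sum>w\<in>W. \<bar>t w\<bar>) + 1"
  have B: "\<bar>t w\<bar> \<le> B" if "w \<in> W" for w
    using member_le_sum[of w W "\<lambda>w. \<bar>t w\<bar>"] that W(1) by (simp add: B_def)
  have "B > 0"
    unfolding B_def by (intro add_nonneg_pos sum_nonneg) auto
  show thesis
  proof (rule that[of "2 * B"])
    fix x y :: "real^3"
    \<comment> \<open>The hitting times of the net lie in [-B, B]; aiming from the point reached at
      time \<open>B\<close> turns them into times in [0, 2 B].\<close>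
    define d where "d = y - x - B *\<^sub>R u"
    have "d - ivec (fl d) \<in> cbox 0 1"
      by (auto simp: mem_box_cart) (metis add.commute diff_le_eq less_eq_real_def real_of_int_floor_add_one_gt)
    then obtain w where w: "w \<in> W" "dist w (d - ivec (fl d)) < e / 2"
      using W(2) by auto
    have "dist (t w *\<^sub>R u) (d - ivec (fl d) + ivec (z w)) < e"
      using dist_triangle_less_add[OF tz[of w], of "d - ivec (fl d) + ivec (z w)" "e / 2"] w(2)
      by (simp add: dist_commute)
    moreover have "t w *\<^sub>R u - (d - ivec (fl d) + ivec (z w)) =
        x + (B + t w) *\<^sub>R u - (y + ivec (z w - fl d))"
      by (simp add: d_def ivec_diff algebra_simps)
    ultimately have "dist (x + (B + t w) *\<^sub>R u) (y + ivec (z w - fl d)) < e"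
      by (simp add: dist_norm)
    then show "\<exists>s z. 0 \<le> s \<and> s \<le> 2 * B \<and> dist (x + s *\<^sub>R u) (y + ivec z) < e"
      using B[OF w(1)] by (intro exI[of _ "B + t w"] exI[of _ "z w - fl d"]) auto
  qed (use \<open>B > 0\<close> in simp)
qed

text \<open>Nothing is required at non-generic times, and only labels in equal or face-adjacent cells are
  related. So a geodesic through an edge, with whatever continuation it chooses there, still gives a
  trajectory, and a limit of trajectories is controlled wherever its line meets no edge.\<close>

definition trajectory :: "real^3 \<Rightarrow> (real \<Rightarrow> 'c) \<Rightarrow> real \<Rightarrow> real \<Rightarrow> bool" where
  "trajectory x k a b \<longleftrightarrow>
    (\<forall>s. a \<le> s \<and> s \<le> b \<and> generic (x + s *\<^sub>R u) \<longrightarrow> k s \<in> C) \<and>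
    (\<forall>s t. a \<le> s \<and> s \<le> t \<and> t \<le> b \<and> generic (x + s *\<^sub>R u) \<and> generic (x + t *\<^sub>R u) \<longrightarrow>
      (fl (x + t *\<^sub>R u) = fl (x + s *\<^sub>R u) \<longrightarrow> k t = k s) \<and>
      (\<forall>i. fl (x + t *\<^sub>R u) = fl (x + s *\<^sub>R u) + exit_vec u i \<longrightarrow> k t = R i (k s)))"

lemma trajectoryD:
  assumes "trajectory x k a b" "a \<le> s" "s \<le> t" "t \<le> b"
    "generic (x + s *\<^sub>R u)" "generic (x + t *\<^sub>R u)"
  shows "k s \<in> C"
    and "fl (x + t *\<^sub>R u) = fl (x + s *\<^sub>R u) \<Longrightarrow> k t = k s"
    and "fl (x + t *\<^sub>R u) = fl (x + s *\<^sub>R u) + exit_vec u i \<Longrightarrow> k t = R i (k s)"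
  using assms unfolding trajectory_def by (simp_all add: order_trans[of s t b])

lemma trajectory_shift:
  assumes "trajectory x k a b" "a \<le> a' + r" "b' + r \<le> b"
  shows "trajectory (x + r *\<^sub>R u + ivec z) (\<lambda>s. k (s + r)) a' b'"
proof -
  have *: "x + r *\<^sub>R u + ivec z + s *\<^sub>R u = x + (s + r) *\<^sub>R u + ivec z" for s
    by (simp add: algebra_simps)
  show ?thesis
    unfolding trajectory_def *
  proof (intro conjI allI impI)
    fix s assume "a' \<le> s \<and> s \<le> b' \<and> generic (x + (s + r) *\<^sub>R u + ivec z)"
    then show "k (s + r) \<in> C"
      using assms unfolding trajectory_def by simp
  next
    fix s t
    assume "a' \<le> s \<and> s \<le> t \<and> t \<le> b' \<and>
      generic (x + (s + r) *\<^sub>R u + ivec z) \<and> generic (x + (t + r) *\<^sub>R u + ivec z)"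
    then have st: "a \<le> s + r" "s + r \<le> t + r" "t + r \<le> b"
      "generic (x + (s + r) *\<^sub>R u)" "generic (x + (t + r) *\<^sub>R u)"
      using assms by auto
    {
      assume "fl (x + (t + r) *\<^sub>R u + ivec z) = fl (x + (s + r) *\<^sub>R u + ivec z)"
      then show "k (t + r) = k (s + r)"
        using assms(1) st unfolding trajectory_def by simp
    next
      fix i
      assume "fl (x + (t + r) *\<^sub>R u + ivec z) = fl (x + (s + r) *\<^sub>R u + ivec z) + exit_vec u i"
      then have "fl (x + (t + r) *\<^sub>R u) = fl (x + (s + r) *\<^sub>R u) + exit_vec u i"
        by (simp add: vec_eq_iff)
      then show "k (t + r) = R i (k (s + r))"
        using assms(1) st unfolding trajectory_def by blast
    }
  qed
qed

section \<open>Lines that meet edges at two different times\<close>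

definition doubly_singular :: "(real^3) set" where
  "doubly_singular = {x. \<exists>s t. s \<noteq> t \<and> singular (x + s *\<^sub>R u) \<and> singular (x + t *\<^sub>R u)}"

lemma doubly_singular_flow:
  assumes "x \<in> doubly_singular"
  shows "x + r *\<^sub>R u + ivec z \<in> doubly_singular"
proof -
  obtain s t where "s \<noteq> t" "singular (x + s *\<^sub>R u)" "singular (x + t *\<^sub>R u)"
    using assms by (auto simp: doubly_singular_def)
  moreover have *: "x + r *\<^sub>R u + ivec z + (s - r) *\<^sub>R u = x + s *\<^sub>R u + ivec z" for s
    by (simp add: algebra_simps)
  ultimately show ?thesis
    unfolding doubly_singular_def
    by (intro CollectI exI[of _ "s - r"] exI[of _ "t - r"]) (simp add: *)
qed

lemma doubly_singular_flow_iff: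
  "x + r *\<^sub>R u + ivec z \<in> doubly_singular \<longleftrightarrow> x \<in> doubly_singular"
proof
  have "x = x + r *\<^sub>R u + ivec z + (- r) *\<^sub>R u + ivec (- z)"
    by (simp add: ivec_uminus)
  then show "x \<in> doubly_singular" if "x + r *\<^sub>R u + ivec z \<in> doubly_singular"
    using doubly_singular_flow[OF that] by metis
qed (rule doubly_singular_flow)

text \<open>The projection along \<open>u\<close> onto the plane where the third coordinate
  vanishes. Its fibres are the lines of the flow, so a countable family of lines becomes a countable
  set in the plane.\<close>

definition proj :: "real^3 \<Rightarrow> real \<times> real" where
  "proj x = (x $ 1 - u $ 1 / u $ 3 * x $ 3, x $ 2 - u $ 2 / u $ 3 * x $ 3)"

lemma linear_proj: "linear proj"
  by (rule linearI) (simp_all add: proj_def algebra_simps del: times_divide_eq_left times_divide_eq_right)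

lemma surj_proj: "surj proj"
proof (rule surjI)
  show "proj (vector [fst p, snd p, 0]) = p" for p
    by (simp add: proj_def)
qed

lemma open_proj: "open A \<Longrightarrow> open (proj ` A)"
  by (rule open_surjective_linear_image[OF _ linear_proj surj_proj])

lemma proj_flow: "proj (x + t *\<^sub>R u) = proj x"
  using u_nonzero[of 3] by (simp add: proj_def field_simps)

lemma proj_eqE:
  assumes "proj x = proj y"
  obtains t where "y = x + t *\<^sub>R u"
proof (rule that)
  show "y = x + ((y $ 3 - x $ 3) / u $ 3) *\<^sub>R u"
    using assms u_nonzero[of 3]
    by (simp add: vec_eq_iff forall_3 proj_def field_simps)
qed

text \<open>Two singular times of one line lie on edges of different directions, because a Kronecker
  line meets the edges of each direction at most once; the integer coordinates at these two times
  determine the line.\<close>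

lemma countable_proj_doubly_singular: "countable (proj ` doubly_singular)"
proof -
  define A where "A = (\<lambda>(i::3, j::3, i'::3, j'::3, a::int, b::int, a'::int, b'::int).
    {x. i \<noteq> j \<and> i' \<noteq> j' \<and> {i, j} \<noteq> {i', j'} \<and> (\<exists>s t.
      x $ i + s * u $ i = of_int a \<and> x $ j + s * u $ j = of_int b \<and>
      x $ i' + t * u $ i' = of_int a' \<and> x $ j' + t * u $ j' = of_int b')})"
  have "x \<in> (\<Union>p. A p)" if "x \<in> doubly_singular" for x
  proof -
    obtain s t where st: "s \<noteq> t" "singular (x + s *\<^sub>R u)" "singular (x + t *\<^sub>R u)"
      using \<open>x \<in> doubly_singular\<close> by (auto simp: doubly_singular_def)
    obtain i j a b where ij: "i \<noteq> j"
      "x $ i + s * u $ i = of_int a" "x $ j + s * u $ j = of_int b"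
      using st(2) by (auto simp: singular_def elim!: Ints_cases)
    obtain i' j' a' b' where ij': "i' \<noteq> j'"
      "x $ i' + t * u $ i' = of_int a'" "x $ j' + t * u $ j' = of_int b'"
      using st(3) by (auto simp: singular_def elim!: Ints_cases)
    have "{i, j} \<noteq> {i', j'}"
    proof
      assume eq: "{i, j} = {i', j'}"
      then obtain a'' b'' :: int where
        2: "x $ i + t * u $ i = of_int a''" "x $ j + t * u $ j = of_int b''"
        using ij' by (metis doubleton_eq_iff)
      \<comment> \<open>Two edges with the same pair of directions would give integer displacements
        proportional to \<open>u $ i\<close> and \<open>u $ j\<close>, hence an integer relation
        between these.\<close>
      have e: "of_int (a - a'') = (s - t) * u $ i" "of_int (b - b'') = (s - t) * u $ j"
        using ij(2,3) 2 by (simp_all add: algebra_simps)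
      then have "of_int (b - b'') * u $ i + of_int (- (a - a'')) * u $ j = 0"
        unfolding of_int_minus e by (simp add: algebra_simps)
      then have "(s - t) * u $ i = 0"
        using integer_relation[OF ij(1)] e(1) by (metis neg_equal_0_iff_equal of_int_0)
      then show False
        using u_nonzero[of i] st(1) by simp
    qed
    then have "x \<in> A (i, j, i', j', a, b, a', b')"
      unfolding A_def using ij ij' by blast
    then show ?thesis by blast
  qed
  then have "proj ` doubly_singular \<subseteq> (\<Union>p. proj ` A p)"
    by blast
  moreover have "countable (proj ` A p)" for p
  proof -
    have "proj x = proj y" if "x \<in> A p" "y \<in> A p" for x y
    proof -
      obtain i j i' j' a b a' b' where p: "p = (i, j, i', j', a, b, a', b')"
        by (cases p) auto
      obtain s t where x: "i \<noteq> j" "i' \<noteq> j'" "{i, j} \<noteq> {i', j'}"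
        "x $ i + s * u $ i = of_int a" "x $ j + s * u $ j = of_int b"
        "x $ i' + t * u $ i' = of_int a'" "x $ j' + t * u $ j' = of_int b'"
        using \<open>x \<in> A p\<close> unfolding A_def p by auto
      obtain s' t' where y:
        "y $ i + s' * u $ i = of_int a" "y $ j + s' * u $ j = of_int b"
        "y $ i' + t' * u $ i' = of_int a'" "y $ j' + t' * u $ j' = of_int b'"
        using \<open>y \<in> A p\<close> unfolding A_def p by auto
      have 1: "(y - x) $ l = (s - s') * u $ l" if "l = i \<or> l = j" for l
        using that x(4,5) y(1,2) by (auto simp: algebra_simps)
      have 2: "(y - x) $ l = (t - t') * u $ l" if "l = i' \<or> l = j'" for l
        using that x(6,7) y(3,4) by (auto simp: algebra_simps)
      \<comment> \<open>The shared direction makes the two time differences agree, so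
        \<open>y - x\<close> is a multiple of \<open>u\<close> in all coordinates.\<close>
      obtain l where "l = i \<or> l = j" "l = i' \<or> l = j'"
        using three_cover[OF x(1-3)] by blast
      then have "s - s' = t - t'"
        using 1[of l] 2[of l] u_nonzero[of l] by simp
      then have "(y - x) $ l = (s - s') * u $ l" for l
        using three_cover[OF x(1-3), of l] 1 2 by auto
      then have "y = x + (s - s') *\<^sub>R u"
        by (simp add: vec_eq_iff algebra_simps)
      then show ?thesis
        by (simp add: proj_flow)
    qed
    then have "\<exists>w. proj ` A p \<subseteq> {w}"
      by blast
    then show ?thesis
      by (meson countable_empty countable_insert countable_subset)
  qed
  ultimately show ?thesis
    by (meson countable_UN countable_subset countableI_type)
qed

text \<open>The projection is an open map, and a non-empty open set of the plane is
  uncountable.\<close>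

lemma open_not_doubly_singular:
  assumes "open A" "A \<noteq> {}"
  obtains x where "x \<in> A" "x \<notin> doubly_singular"
proof -
  have "open (proj ` A)" "proj ` A \<noteq> {}"
    using assms by (auto intro: open_proj)
  then have "uncountable (proj ` A)"
    by (metis countable_subset ex_in_conv open_contains_ball uncountable_ball)
  then have "\<not> A \<subseteq> doubly_singular"
    using countable_proj_doubly_singular by (meson countable_subset image_mono)
  then show thesis
    using that by blast
qed

text \<open>The points with \<open>q $ i = 0\<close> and both other coordinates equal to
  \<open>s\<close> lie on different lines for different \<open>s\<close>, because
  \<open>u $ i\<close> is nonzero. Uncountably many lines thus compete against countably many
  exceptions.\<close>

lemma face_point:
  obtains q where "q $ i \<in> \<int>" "\<And>j. j \<noteq> i \<Longrightarrow> q $ j \<notin> \<int>" "q \<notin> doubly_singular"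
proof -
  define q :: "real \<Rightarrow> real^3" where "q = (\<lambda>s. \<chi> j. if j = i then 0 else s)"
  obtain j where j: "j \<noteq> i"
    by (rule that[of "i + 1"]) simp
  have "inj (\<lambda>s. proj (q s))"
  proof (rule injI)
    fix s s' assume "proj (q s) = proj (q s')"
    then obtain t where t: "q s' = q s + t *\<^sub>R u"
      by (rule proj_eqE)
    have "q s' $ i = q s $ i + t * u $ i" "q s' $ j = q s $ j + t * u $ j"
      unfolding t by simp_all
    then show "s = s'"
      using u_nonzero[of i] j by (simp add: q_def)
  qed
  then have "uncountable ((\<lambda>s. proj (q s)) ` {0<..<1})"
    by (metis countable_image_inj_on inj_on_subset subset_UNIV uncountable_open_interval zero_less_one)
  then have "\<not> (\<lambda>s. proj (q s)) ` {0<..<1} \<subseteq> proj ` doubly_singular"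
    using countable_proj_doubly_singular countable_subset by blast
  then obtain s where s: "0 < s" "s < 1" "q s \<notin> doubly_singular"
    unfolding image_subset_iff by (metis greaterThanLessThan_iff imageI)
  have "s \<notin> \<int>"
    using s by (auto elim!: Ints_cases)
  then show thesis
    using s(3) by (intro that[of "q s"]) (auto simp: q_def)
qed


end

section \<open>An open set on one sheet that is missed for arbitrarily long times\<close>

locale missed_set = cell_flow C R u
  for C :: "'c set" and R u +
  fixes g :: 'c and U :: "(real^3) set"
  assumes g: "g \<in> C"
    and U: "open U" "U \<noteq> {}" "U \<subseteq> box 0 1"
    and missed: "\<exists>x k. trajectory x k (- N) N \<and> (\<forall>s. - N \<le> s \<and> s \<le> N \<longrightarrow>
      \<not> (generic (x + s *\<^sub>R u) \<and> k s = g \<and> x + s *\<^sub>R u - ivec (fl (x + s *\<^sub>R u)) \<in> U))"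
begin

definition avoids :: "real^3 \<Rightarrow> (real \<Rightarrow> 'c) \<Rightarrow> real \<Rightarrow> real \<Rightarrow> bool" where
  "avoids x k a b \<longleftrightarrow> trajectory x k a b \<and> (\<forall>s. a \<le> s \<and> s \<le> b \<longrightarrow>
    \<not> (generic (x + s *\<^sub>R u) \<and> k s = g \<and> x + s *\<^sub>R u - ivec (fl (x + s *\<^sub>R u)) \<in> U))"

lemma avoids_shift:
  assumes "avoids x k a b" "a \<le> a' + r" "b' + r \<le> b"
  shows "avoids (x + r *\<^sub>R u + ivec z) (\<lambda>s. k (s + r)) a' b'"
proof -
  have *: "x + r *\<^sub>R u + ivec z + s *\<^sub>R u = x + (s + r) *\<^sub>R u + ivec z" for s
    by (simp add: algebra_simps)
  have **: "x + ivec z - ivec (fl x + z) = x - ivec (fl x)" for x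
    by (simp add: ivec_add)
  have "trajectory (x + r *\<^sub>R u + ivec z) (\<lambda>s. k (s + r)) a' b'"
    using assms trajectory_shift unfolding avoids_def by blast
  moreover have "\<not> (generic (x + (s + r) *\<^sub>R u) \<and> k (s + r) = g \<and>
      x + (s + r) *\<^sub>R u - ivec (fl (x + (s + r) *\<^sub>R u)) \<in> U)" if "a' \<le> s \<and> s \<le> b'" for s
    using assms that unfolding avoids_def by simp
  ultimately show ?thesis
    unfolding avoids_def * fl_add_ivec generic_add_ivec ** by blast
qed

text \<open>The window is two-sided because labels are transported both forwards and backwards;
  moving its centre by \<open>r\<close> costs \<open>\<bar>r\<bar>\<close> of its
  half-length.\<close>

definition bad :: "real \<Rightarrow> real^3 \<Rightarrow> 'c \<Rightarrow> bool" where
  "bad N x c \<longleftrightarrow> (\<exists>k. avoids x k (- N) N \<and> k 0 = c)"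

lemma bad_flow:
  assumes "avoids x k (- N) N" "\<bar>r\<bar> + M \<le> N"
  shows "bad M (x + r *\<^sub>R u + ivec z) (k r)"
  unfolding bad_def using avoids_shift[OF assms(1), of "- M" r M z] assms(2)
  by (intro exI[of _ "\<lambda>s. k (s + r)"]) simp

lemma bad_mono: "bad N x c \<Longrightarrow> M \<le> N \<Longrightarrow> bad M x c"
  using bad_flow[of x _ N 0 M 0] by (auto simp: bad_def)

lemma bad_add_ivec: "bad N x c \<Longrightarrow> bad N (x + ivec z) c"
  using bad_flow[of x _ N 0 N z] by (auto simp: bad_def)

text \<open>The upper limit, as \<open>N\<close> grows and \<open>y\<close> tends to
  \<open>x\<close>, of the sets of labels that \<open>bad\<close> admits at \<open>y\<close>. A
  label outside is excluded by a single pair \<open>e\<close>, \<open>N\<close>; as there are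
  finitely many labels, one pair can exclude them all.\<close>

definition bad_labels :: "real^3 \<Rightarrow> 'c set" where
  "bad_labels x = {c \<in> C. \<forall>e>0. \<forall>N. \<exists>y. dist x y < e \<and> bad N y c}"

lemma bad_labelsE:
  assumes "c \<in> bad_labels x" "e > 0"
  obtains y where "dist x y < e" "bad N y c"
  using assms unfolding bad_labels_def by blast

lemma bad_labels_subset: "bad_labels x \<subseteq> C"
  by (auto simp: bad_labels_def)

lemma finite_lim: "finite (bad_labels x)"
  using bad_labels_subset finite_C finite_subset by blast

lemma bad_labels_add_ivec [simp]: "bad_labels (x + ivec z) = bad_labels x"
proof -
  have "bad_labels x \<subseteq> bad_labels (x + ivec z)" for x z
  proof
    fix c assume c: "c \<in> bad_labels x"
    have "\<exists>y. dist (x + ivec z) y < e \<and> bad N y c" if "e > 0" for e N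
    proof -
      obtain y where "dist x y < e" "bad N y c"
        using c \<open>e > 0\<close> by (rule bad_labelsE)
      then show ?thesis
        by (intro exI[of _ "y + ivec z"]) (simp add: bad_add_ivec)
    qed
    then show "c \<in> bad_labels (x + ivec z)"
      using c by (simp add: bad_labels_def)
  qed
  from this[of x z] this[of "x + ivec z" "- z"] show ?thesis
    by (auto simp: ivec_uminus)
qed

text \<open>A pair \<open>e\<close>, \<open>N\<close> that excludes a label at \<open>x\<close>
  still excludes it, with radius \<open>e / 2\<close>, at every point within \<open>e / 2\<close>.
  Finiteness of \<open>C\<close> gives a common radius.\<close>

lemma bad_labels_upper_semicontinuous:
  obtains e where "e > 0" "\<And>y. dist x y < e \<Longrightarrow> bad_labels y \<subseteq> bad_labels x"
proof -
  have "\<forall>c\<in>C - bad_labels x. \<forall>\<^sub>F y in nhds x. c \<notin> bad_labels y"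
  proof
    fix c assume "c \<in> C - bad_labels x"
    then obtain e N where e: "e > 0" "\<And>y. dist x y < e \<Longrightarrow> \<not> bad N y c"
      by (auto simp: bad_labels_def)
    have "c \<notin> bad_labels y" if "dist y x < e / 2" for y
    proof
      assume "c \<in> bad_labels y"
      then obtain y' where "dist y y' < e / 2" "bad N y' c"
        using bad_labelsE half_gt_zero[OF e(1)] by blast
      then show False
        using e(2)[of y'] that dist_triangle_half_r[of y x e y'] by blast
    qed
    then show "\<forall>\<^sub>F y in nhds x. c \<notin> bad_labels y"
      using e(1) unfolding eventually_nhds_metric by (meson half_gt_zero)
  qed
  then have "\<forall>\<^sub>F y in nhds x. \<forall>c\<in>C - bad_labels x. c \<notin> bad_labels y"
    by (intro eventually_ball_finite) (use finite_C in auto)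
  then obtain e where "e > 0" "\<And>y. dist y x < e \<Longrightarrow> \<forall>c\<in>C - bad_labels x. c \<notin> bad_labels y"
    unfolding eventually_nhds_metric by blast
  then show thesis
    using bad_labels_subset by (intro that[of e]) (auto simp: dist_commute)
qed

text \<open>By \<open>tr\<close>, every trajectory that is near \<open>x\<close> at time 0 changes
  its label by \<open>f\<close> up to time \<open>t\<close>. Windows are shifted backwards for one
  inclusion, where injectivity of \<open>f\<close> recovers the label, and forwards for the
  other.\<close>

lemma bad_labels_transport:
  assumes f: "bij_betw f C C" and t: "t \<ge> 0" and e: "e > 0"
    and tr: "\<And>y k a b. dist x y < e \<Longrightarrow> trajectory y k a b \<Longrightarrow> a \<le> 0 \<Longrightarrow> t \<le> b \<Longrightarrow>
      k 0 \<in> C \<and> k t = f (k 0)"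
  shows "bad_labels (x + t *\<^sub>R u) = f ` bad_labels x"
proof (intro set_eqI iffI)
  fix d assume d: "d \<in> bad_labels (x + t *\<^sub>R u)"
  then have "d \<in> C"
    by (simp add: bad_labels_def)
  then obtain c where c: "c \<in> C" "f c = d"
    using f by (metis bij_betw_imp_surj_on imageE)
  have "\<exists>y. dist x y < e' \<and> bad N y c" if "e' > 0" for e' N
  proof -
    \<comment> \<open>The shift uses up \<open>t\<close> of the window, and \<open>N\<close> may be
      negative.\<close>
    define M where "M = max N 0 + t"
    have "min e e' > 0"
      using e \<open>e' > 0\<close> by simp
    with d obtain y where y: "dist (x + t *\<^sub>R u) y < min e e'" "bad M y d"
      by (rule bad_labelsE)
    then obtain k where k: "avoids y k (- M) M" "k 0 = d"
      by (auto simp: bad_def)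
    have dist: "dist x (y + (- t) *\<^sub>R u + ivec 0) < min e e'"
      using y(1) by (simp add: dist_norm algebra_simps)
    have "trajectory (y + (- t) *\<^sub>R u + ivec 0) (\<lambda>s. k (s + - t)) 0 t"
      by (rule trajectory_shift[of _ _ "- M" M]) (use k(1) t in \<open>auto simp: avoids_def M_def\<close>)
    from tr[OF _ this] have "k (- t) \<in> C" "k 0 = f (k (- t))"
      using dist t by auto
    then have "k (- t) = c"
      using c k(2) f by (auto simp: bij_betw_def inj_on_def)
    moreover have "bad N (y + (- t) *\<^sub>R u + ivec 0) (k (- t))"
      by (rule bad_flow[OF k(1)]) (use t in \<open>auto simp: M_def\<close>)
    ultimately show ?thesis
      using dist by auto
  qed
  then show "d \<in> f ` bad_labels x"
    using c by (auto simp: bad_labels_def)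
next
  fix d assume "d \<in> f ` bad_labels x"
  then obtain c where c: "c \<in> bad_labels x" "d = f c" by blast
  have "\<exists>y. dist (x + t *\<^sub>R u) y < e' \<and> bad N y d" if "e' > 0" for e' N
  proof -
    define M where "M = max N 0 + t"
    have "min e e' > 0"
      using e \<open>e' > 0\<close> by simp
    with c(1) obtain y where y: "dist x y < min e e'" "bad M y c"
      by (rule bad_labelsE)
    then obtain k where k: "avoids y k (- M) M" "k 0 = c"
      by (auto simp: bad_def)
    have "k t = d"
      using tr[of y k "- M" M] y(1) k c(2) t by (simp add: avoids_def M_def)
    then have "bad N (y + t *\<^sub>R u + ivec 0) d"
      using bad_flow[OF k(1), of t N 0] t by (simp add: M_def)
    then show ?thesis
      using y(1) by (intro exI[of _ "y + t *\<^sub>R u + ivec 0"]) (simp add: dist_norm)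
  qed
  moreover have "d \<in> C"
    using c f bad_labels_subset by (auto simp: bij_betw_def)
  ultimately show "d \<in> bad_labels (x + t *\<^sub>R u)"
    by (simp add: bad_labels_def)
qed

text \<open>Both endpoints lie in open cells, so nearby starting points run between the same two
  cells, and the definition of a trajectory prescribes the change of label.\<close>

lemma bad_labels_flow:
  assumes x: "generic x" "generic (x + t *\<^sub>R u)" and t: "t \<ge> 0"
  shows "fl (x + t *\<^sub>R u) = fl x \<Longrightarrow> bad_labels (x + t *\<^sub>R u) = bad_labels x"
    and "fl (x + t *\<^sub>R u) = fl x + exit_vec u i \<Longrightarrow> bad_labels (x + t *\<^sub>R u) = R i ` bad_labels x"
proof -
  obtain e1 where e1: "e1 > 0" "\<And>y. dist x y < e1 \<Longrightarrow> generic y \<and> fl y = fl x"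
    using cell_ball[OF x(1)] by blast
  obtain e2 where e2: "e2 > 0"
    "\<And>y. dist (x + t *\<^sub>R u) y < e2 \<Longrightarrow> generic y \<and> fl y = fl (x + t *\<^sub>R u)"
    using cell_ball[OF x(2)] by blast
  define e where "e = min e1 e2"
  have e: "e > 0" "\<And>y. dist x y < e \<Longrightarrow> generic y \<and> fl y = fl x \<and>
      generic (y + t *\<^sub>R u) \<and> fl (y + t *\<^sub>R u) = fl (x + t *\<^sub>R u)"
  proof -
    show "e > 0"
      using e1(1) e2(1) by (simp add: e_def)
    fix y assume "dist x y < e"
    then have "dist x y < e1" "dist (x + t *\<^sub>R u) (y + t *\<^sub>R u) < e2"
      by (simp_all add: e_def)
    then show "generic y \<and> fl y = fl x \<and>
      generic (y + t *\<^sub>R u) \<and> fl (y + t *\<^sub>R u) = fl (x + t *\<^sub>R u)"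
      using e1(2) e2(2) by blast
  qed
  have tr: "k 0 \<in> C \<and> (fl (x + t *\<^sub>R u) = fl x \<longrightarrow> k t = k 0) \<and>
      (fl (x + t *\<^sub>R u) = fl x + exit_vec u i \<longrightarrow> k t = R i (k 0))"
    if "dist x y < e" "trajectory y k a b" "a \<le> 0" "t \<le> b" for y k a b
  proof -
    have "generic (y + 0 *\<^sub>R u)" "fl (y + 0 *\<^sub>R u) = fl x"
      "generic (y + t *\<^sub>R u)" "fl (y + t *\<^sub>R u) = fl (x + t *\<^sub>R u)"
      using e(2)[OF that(1)] by simp_all
    then show ?thesis
      using trajectoryD[OF that(2,3) t that(4)] by simp
  qed
  {
    assume "fl (x + t *\<^sub>R u) = fl x"
    with tr have "k 0 \<in> C \<and> k t = id (k 0)"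
      if "dist x y < e" "trajectory y k a b" "a \<le> 0" "t \<le> b" for y k a b
      using that unfolding id_apply by blast
    from bad_labels_transport[OF bij_betw_id t e(1) this] show "bad_labels (x + t *\<^sub>R u) = bad_labels x"
      by simp
  next
    assume "fl (x + t *\<^sub>R u) = fl x + exit_vec u i"
    with tr have "k 0 \<in> C \<and> k t = R i (k 0)"
      if "dist x y < e" "trajectory y k a b" "a \<le> 0" "t \<le> b" for y k a b
      using that by blast
    from bad_labels_transport[OF bij_R t e(1) this] show "bad_labels (x + t *\<^sub>R u) = R i ` bad_labels x" .
  }
qed

text \<open>Otherwise one radius and one window length exclude every label near \<open>x\<close>.
  But a long avoiding trajectory comes that close to \<open>x\<close>, modulo integers, after
  bounded time, and carries some label there.\<close>

lemma bad_labels_nonempty: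
  assumes "generic x"
  shows "bad_labels x \<noteq> {}"
proof
  assume empty: "bad_labels x = {}"
  obtain e0 where e0: "e0 > 0" "\<And>y. dist x y < e0 \<Longrightarrow> generic y \<and> fl y = fl x"
    using cell_ball[OF assms] by blast
  have small: "\<forall>\<^sub>F n in sequentially. 1 / real (Suc n) < e" if "e > 0" for e
    using LIMSEQ_inverse_real_of_nat order_tendstoD(2)[OF _ that, of "\<lambda>n. inverse (real (Suc n))"]
    by (simp add: inverse_eq_divide)
  have "\<forall>c\<in>C. \<forall>\<^sub>F n in sequentially. \<forall>y. dist x y < 1 / real (Suc n) \<longrightarrow> \<not> bad (real n) y c"
  proof
    fix c assume "c \<in> C"
    then have "c \<in> C - bad_labels x"
      using empty by simp
    then obtain e N where e: "e > 0" "\<And>y. dist x y < e \<Longrightarrow> \<not> bad N y c"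
      by (auto simp: bad_labels_def)
    show "\<forall>\<^sub>F n in sequentially. \<forall>y. dist x y < 1 / real (Suc n) \<longrightarrow> \<not> bad (real n) y c"
      using small[OF e(1)] eventually_ge_at_top[of "nat \<lceil>N\<rceil>"]
    proof eventually_elim
      case (elim n)
      then have "N \<le> real n"
        by (simp add: nat_le_iff ceiling_le_iff)
      then show ?case
        using elim e(2) bad_mono by (meson order.strict_trans)
    qed
  qed
  then have "\<forall>\<^sub>F n in sequentially. \<forall>c\<in>C. \<forall>y. dist x y < 1 / real (Suc n) \<longrightarrow> \<not> bad (real n) y c"
    by (rule eventually_ball_finite[OF finite_C])
  with small[OF e0(1)] have "\<forall>\<^sub>F n in sequentially. 1 / real (Suc n) < e0 \<and>
      (\<forall>c\<in>C. \<forall>y. dist x y < 1 / real (Suc n) \<longrightarrow> \<not> bad (real n) y c)"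
    by (rule eventually_conj)
  then obtain n where n: "1 / real (Suc n) < e0"
    "\<And>c y. c \<in> C \<Longrightarrow> dist x y < 1 / real (Suc n) \<Longrightarrow> \<not> bad (real n) y c"
    using eventually_happens'[OF sequentially_bot] by blast
  obtain T where T: "T > 0"
    "\<And>x y. \<exists>s z. 0 \<le> s \<and> s \<le> T \<and> dist (x + s *\<^sub>R u) (y + ivec z) < 1 / real (Suc n)"
    using uniform_density[of "1 / real (Suc n)"] by auto
  \<comment> \<open>The extra \<open>T\<close> leaves a window of half-length \<open>n\<close>
    around any hitting time in [0, T].\<close>
  obtain y k where yk: "avoids y k (- (real n + T)) (real n + T)"
    using missed unfolding avoids_def by blast
  obtain s z where s: "0 \<le> s" "s \<le> T" "dist (y + s *\<^sub>R u) (x + ivec z) < 1 / real (Suc n)"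
    using T(2) by blast
  have near: "dist x (y + s *\<^sub>R u + ivec (- z)) < 1 / real (Suc n)"
    using s(3) by (simp add: dist_norm ivec_uminus norm_minus_commute algebra_simps)
  then have "generic (y + s *\<^sub>R u)"
    using e0(2) n(1) generic_add_ivec by (meson order.strict_trans)
  then have "k s \<in> C"
    using yk s unfolding avoids_def trajectory_def by auto
  moreover have "bad (real n) (y + s *\<^sub>R u + ivec (- z)) (k s)"
    by (rule bad_flow[OF yk]) (use s in auto)
  ultimately show False
    using n(2) near by blast
qed

text \<open>Near each time the label sets at generic points differ by a permutation, so their
  cardinality is locally constant. Non-generic times are bridged by an induction over the connected
  time interval that asks only for a good time in each open piece.\<close>

lemma card_lim_flow:
  assumes x: "generic x" "generic (x + t *\<^sub>R u)" and t: "t \<ge> 0"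
    and ns: "\<And>r. 0 \<le> r \<Longrightarrow> r \<le> t \<Longrightarrow> \<not> singular (x + r *\<^sub>R u)"
  shows "card (bad_labels (x + t *\<^sub>R u)) = card (bad_labels x)"
proof (cases "t = 0")
  case False
  then have "t > 0" using t by simp
  define S where "S = {0..t}"
  have card_R: "card (R i ` bad_labels y) = card (bad_labels y)" for i y
    using bij_R[of i] bad_labels_subset by (intro card_image) (auto simp: bij_betw_def inj_on_def subset_iff)
  show ?thesis
  proof (rule connected_induction[of S "\<lambda>r. generic (x + r *\<^sub>R u)" _ 0 t])
    show "connected S" "0 \<in> S" "t \<in> S"
      using t by (auto simp: S_def)
    show "generic (x + 0 *\<^sub>R u)" "generic (x + t *\<^sub>R u)" "card (bad_labels (x + 0 *\<^sub>R u)) = card (bad_labels x)"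
      using x by simp_all
  next
    fix T a assume T: "openin (top_of_set S) T" "a \<in> T"
    then obtain e where e: "e > 0" "ball a e \<inter> S \<subseteq> T"
      using openin_contains_ball by metis
    have a: "0 \<le> a" "a \<le> t"
      using T openin_imp_subset by (fastforce simp: S_def)+
    obtain d where d: "d > 0" "\<And>s. \<bar>s\<bar> < d \<Longrightarrow> s \<noteq> 0 \<Longrightarrow> generic (x + a *\<^sub>R u + s *\<^sub>R u)"
      using generic_near_point[OF u_nonzero, where q = "x + a *\<^sub>R u"] by blast
    \<comment> \<open>A nonzero shift of \<open>a\<close> into the interval, small enough to reach a
      generic time inside \<open>T\<close>.\<close>
    define s where "s = (if a < t then min (min d e) (t - a) / 2 else - min (min d e) t / 2)"
    have s: "\<bar>s\<bar> < d" "s \<noteq> 0" "\<bar>s\<bar> < e" "0 \<le> a + s" "a + s \<le> t"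
      using d(1) e(1) a \<open>t > 0\<close> by (auto simp: s_def min_def field_simps)
    have "a + s \<in> T"
      using e(2) s by (auto simp: S_def dist_real_def)
    moreover have "generic (x + (a + s) *\<^sub>R u)"
      using d(2)[OF s(1,2)] by (simp add: algebra_simps)
    ultimately show "\<exists>z. z \<in> T \<and> generic (x + z *\<^sub>R u)"
      by blast
  next
    fix a assume "a \<in> S"
    then have "\<not> singular (x + a *\<^sub>R u)"
      using ns by (simp add: S_def)
    from local_crossing[OF u_nonzero this] obtain d where d: "d > 0"
      "\<And>s t. - d < s \<Longrightarrow> s \<le> t \<Longrightarrow> t < d \<Longrightarrow> generic (x + a *\<^sub>R u + s *\<^sub>R u) \<Longrightarrow>
        generic (x + a *\<^sub>R u + t *\<^sub>R u) \<Longrightarrow>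
        fl (x + a *\<^sub>R u + t *\<^sub>R u) = fl (x + a *\<^sub>R u + s *\<^sub>R u) \<or>
        (\<exists>i. fl (x + a *\<^sub>R u + t *\<^sub>R u) = fl (x + a *\<^sub>R u + s *\<^sub>R u) + exit_vec u i)"
      by blast
    have le: "card (bad_labels (x + r *\<^sub>R u)) = card (bad_labels (x + r' *\<^sub>R u))"
      if "dist a r < d" "dist a r' < d" "r \<le> r'"
        "generic (x + r *\<^sub>R u)" "generic (x + r' *\<^sub>R u)" for r r'
    proof -
      have eq: "x + a *\<^sub>R u + (s - a) *\<^sub>R u = x + s *\<^sub>R u"
        "x + r *\<^sub>R u + (s - r) *\<^sub>R u = x + s *\<^sub>R u" for s
        by (simp_all add: algebra_simps)
      have "fl (x + r' *\<^sub>R u) = fl (x + r *\<^sub>R u) \<or>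
          (\<exists>i. fl (x + r' *\<^sub>R u) = fl (x + r *\<^sub>R u) + exit_vec u i)"
        using d(2)[of "r - a" "r' - a"] that by (auto simp: eq dist_real_def)
      then show ?thesis
        using bad_labels_flow[of "x + r *\<^sub>R u" "r' - r"] that card_R unfolding eq by auto
    qed
    have "card (bad_labels (x + r *\<^sub>R u)) = card (bad_labels (x + r' *\<^sub>R u))"
      if "r \<in> ball a d" "r' \<in> ball a d" "generic (x + r *\<^sub>R u)" "generic (x + r' *\<^sub>R u)" for r r'
    proof (cases "r \<le> r'")
      case True
      then show ?thesis
        using that by (intro le) simp_all
    next
      case False
      then show ?thesis
        using that by (intro le[symmetric]) simp_all
    qed
    then have "\<forall>r\<in>S \<inter> ball a d. \<forall>r'\<in>S \<inter> ball a d.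
        generic (x + r *\<^sub>R u) \<and> generic (x + r' *\<^sub>R u) \<and>
        card (bad_labels (x + r *\<^sub>R u)) = card (bad_labels x) \<longrightarrow>
        card (bad_labels (x + r' *\<^sub>R u)) = card (bad_labels x)"
      by (metis IntD2)
    moreover have "openin (top_of_set S) (S \<inter> ball a d)"
      by (intro openin_open_Int open_ball)
    moreover have "a \<in> S \<inter> ball a d"
      using d(1) \<open>a \<in> S\<close> by simp
    ultimately show "\<exists>T. openin (top_of_set S) T \<and> a \<in> T \<and>
      (\<forall>r\<in>T. \<forall>r'\<in>T. generic (x + r *\<^sub>R u) \<and> generic (x + r' *\<^sub>R u) \<and>
        card (bad_labels (x + r *\<^sub>R u)) = card (bad_labels x) \<longrightarrow>
        card (bad_labels (x + r' *\<^sub>R u)) = card (bad_labels x))"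
      by (intro exI[of _ "S \<inter> ball a d"] conjI)
  qed
qed simp

text \<open>Around a point of minimal cardinality, semicontinuity and minimality fix the cardinality
  on a ball. Every line enters this ball modulo integers in the future and in the past, so a generic
  point with another cardinality has an edge on either side of it on its line.\<close>

lemma card_lim_constant:
  obtains m where "\<And>x. generic x \<Longrightarrow> x \<notin> doubly_singular \<Longrightarrow> card (bad_labels x) = m"
proof -
  obtain p :: "real^3" where "generic p"
  proof (rule generic_near_point[OF u_nonzero, of 0])
    fix d :: real
    assume "d > 0" "\<And>s. \<bar>s\<bar> < d \<Longrightarrow> s \<noteq> 0 \<Longrightarrow> generic (0 + s *\<^sub>R u)"
    from this(2)[of "d / 2"] \<open>d > 0\<close> show thesis
      by (intro that[of "0 + (d / 2) *\<^sub>R u"]) simp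
  qed
  then obtain p where p: "generic p" "\<And>y. generic y \<Longrightarrow> card (bad_labels p) \<le> card (bad_labels y)"
    using ex_has_least_nat[of generic p "\<lambda>x. card (bad_labels x)"] by blast
  obtain e1 where e1: "e1 > 0" "\<And>y. dist p y < e1 \<Longrightarrow> generic y \<and> fl y = fl p"
    using cell_ball[OF p(1)] by blast
  obtain e2 where e2: "e2 > 0" "\<And>y. dist p y < e2 \<Longrightarrow> bad_labels y \<subseteq> bad_labels p"
    using bad_labels_upper_semicontinuous by blast
  have near: "generic y \<and> card (bad_labels y) = card (bad_labels p)" if "dist p y < min e1 e2" for y
    using e1(2)[of y] e2(2)[of y] that p(2)[of y] card_mono[OF finite_lim, of "bad_labels y" p] by auto
  obtain T where T: "T > 0"
    "\<And>x y. \<exists>s z. 0 \<le> s \<and> s \<le> T \<and> dist (x + s *\<^sub>R u) (y + ivec z) < min e1 e2"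
    using uniform_density[of "min e1 e2"] e1(1) e2(1) by auto
  have hit: "\<exists>s. 0 \<le> s \<and> s \<le> T \<and> generic (x + s *\<^sub>R u) \<and> card (bad_labels (x + s *\<^sub>R u)) = card (bad_labels p)" for x
  proof -
    obtain s z where s: "0 \<le> s" "s \<le> T" "dist (x + s *\<^sub>R u) (p + ivec z) < min e1 e2"
      using T(2) by blast
    have "dist p (x + s *\<^sub>R u + ivec (- z)) < min e1 e2"
      using s(3) by (simp add: dist_norm ivec_uminus norm_minus_commute algebra_simps)
    from near[OF this] show ?thesis
      using s by auto
  qed
  have "card (bad_labels x) = card (bad_labels p)" if x: "generic x" "x \<notin> doubly_singular" for x
  proof (rule ccontr)
    assume ne: "card (bad_labels x) \<noteq> card (bad_labels p)"
    obtain s where s: "0 \<le> s" "generic (x + s *\<^sub>R u)" "card (bad_labels (x + s *\<^sub>R u)) = card (bad_labels p)"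
      using hit by blast
    obtain r where r: "0 \<le> r" "singular (x + r *\<^sub>R u)"
      using card_lim_flow[OF x(1) s(2,1)] s(3) ne by auto
    \<comment> \<open>Searching from time \<open>- T\<close> on finds a hit in the past of
      \<open>x\<close>, at time \<open>s' - T\<close>.\<close>
    obtain s' where s': "0 \<le> s'" "s' \<le> T" "generic (x + (- T) *\<^sub>R u + s' *\<^sub>R u)"
      "card (bad_labels (x + (- T) *\<^sub>R u + s' *\<^sub>R u)) = card (bad_labels p)"
      using hit by blast
    define w where "w = T - s'"
    have w: "w \<ge> 0" "generic (x - w *\<^sub>R u)" "card (bad_labels (x - w *\<^sub>R u)) = card (bad_labels p)"
      using s' by (auto simp: w_def algebra_simps)
    have eq: "x - w *\<^sub>R u + w *\<^sub>R u = x"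
      by simp
    obtain q where q: "0 \<le> q" "q \<le> w" "singular (x - w *\<^sub>R u + q *\<^sub>R u)"
      using card_lim_flow[OF w(2) _ w(1)] w(3) x(1) ne unfolding eq by metis
    then have q': "singular (x + (q - w) *\<^sub>R u)"
      by (simp add: algebra_simps)
    \<comment> \<open>One edge time is nonnegative and the other nonpositive; equality would put an
      edge at the generic point \<open>x\<close>.\<close>
    have "r \<noteq> q - w"
    proof
      assume "r = q - w"
      then have "r = 0"
        using q r by simp
      then show False
        using r(2) x(1) generic_not_singular by simp
    qed
    then show False
      using x(2) r(2) q' unfolding doubly_singular_def by blast
  qed
  then show thesis
    by (rule that)
qed

text \<open>Inside a cell the set is constant along the flow, hence a function on the projection of the cell
  to the plane, where removing countably many points leaves a connected set.\<close>

lemma bad_labels_constant: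
  obtains D where "\<And>x. generic x \<Longrightarrow> x \<notin> doubly_singular \<Longrightarrow> bad_labels x = D"
proof -
  obtain m where m: "\<And>x. generic x \<Longrightarrow> x \<notin> doubly_singular \<Longrightarrow> card (bad_labels x) = m"
    by (rule card_lim_constant) (rule that; assumption)
  define W where "W = {x. generic x \<and> fl x = 0}"
  define V where "V = proj ` W - proj ` doubly_singular"
  have W: "open W" "connected W"
    unfolding W_def cell_eq_box by (auto intro: convex_connected)
  have "connected V"
    unfolding V_def
    by (intro connected_open_diff_countable open_proj W connected_linear_image linear_proj
        countable_proj_doubly_singular) simp
  have fibre: "bad_labels x = bad_labels y" if W: "x \<in> W" "y \<in> W" and eq: "proj x = proj y" for x y
  proof -
    have *: "bad_labels x = bad_labels y" if xy: "x \<in> W" "y \<in> W" "y = x + t *\<^sub>R u" "t \<ge> 0" for x y t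
      using bad_labels_flow(1)[of x t] xy by (simp add: W_def)
    obtain t where t: "y = x + t *\<^sub>R u"
      using eq by (rule proj_eqE)
    show ?thesis
    proof (cases "t \<ge> 0")
      case True
      then show ?thesis
        by (rule *[OF W t])
    next
      case False
      have "x = y + (- t) *\<^sub>R u"
        by (simp add: t)
      from *[OF W(2,1) this] False show ?thesis
        by simp
    qed
  qed
  have proj_ds: "proj x \<in> proj ` doubly_singular \<longleftrightarrow> x \<in> doubly_singular" for x
  proof
    assume "proj x \<in> proj ` doubly_singular"
    then obtain y where "y \<in> doubly_singular" "proj x = proj y"
      by blast
    then show "x \<in> doubly_singular"
      using doubly_singular_flow_iff[of x _ 0] by (metis add.right_neutral ivec_0 proj_eqE)
  qed blast
  have const: "bad_labels x = bad_labels y" if x: "x \<in> W - doubly_singular" and y: "y \<in> W - doubly_singular" for x y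
  proof -
    \<comment> \<open>The induction runs over points of the plane with a predicate on whole fibres;
      by \<open>fibre\<close>, one point of each fibre suffices.\<close>
    have "\<forall>z\<in>W. proj z = proj y \<longrightarrow> bad_labels z = bad_labels x"
    proof (rule connected_induction_simple[OF \<open>connected V\<close>,
          where P = "\<lambda>w. \<forall>z\<in>W. proj z = w \<longrightarrow> bad_labels z = bad_labels x"])
      show "proj x \<in> V" "proj y \<in> V"
        using x y by (auto simp: V_def proj_ds)
      show "\<forall>z\<in>W. proj z = proj x \<longrightarrow> bad_labels z = bad_labels x"
        using fibre x by blast
    next
      fix w assume "w \<in> V"
      then obtain p where p: "p \<in> W" "p \<notin> doubly_singular" "w = proj p"
        by (auto simp: V_def proj_ds)
      obtain e where e: "e > 0" "\<And>y. dist p y < e \<Longrightarrow> bad_labels y \<subseteq> bad_labels p"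
        using bad_labels_upper_semicontinuous by blast
      \<comment> \<open>Semicontinuity gives an inclusion, which equal cardinalities turn into
        equality.\<close>
      have eq: "bad_labels q = bad_labels p" if "q \<in> W" "dist p q < e" "q \<notin> doubly_singular" for q
        using e(2)[OF that(2)] m[of p] m[of q] p that finite_lim
        by (intro card_subset_eq) (auto simp: W_def)
      define T where "T = V \<inter> proj ` (ball p e \<inter> W)"
      have "\<forall>z\<in>W. proj z = w2 \<longrightarrow> bad_labels z = bad_labels x"
        if w12: "w1 \<in> T" "w2 \<in> T" and P: "\<forall>z\<in>W. proj z = w1 \<longrightarrow> bad_labels z = bad_labels x" for w1 w2
      proof -
        obtain q1 where q1: "q1 \<in> W" "dist p q1 < e" "w1 = proj q1" "q1 \<notin> doubly_singular"
          using w12(1) by (auto simp: T_def V_def proj_ds)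
        obtain q2 where q2: "q2 \<in> W" "dist p q2 < e" "w2 = proj q2" "q2 \<notin> doubly_singular"
          using w12(2) by (auto simp: T_def V_def proj_ds)
        have "bad_labels q2 = bad_labels x"
          using eq[OF q1(1,2,4)] eq[OF q2(1,2,4)] P q1 by metis
        then show ?thesis
          using fibre q2 by metis
      qed
      then have "\<forall>w1\<in>T. \<forall>w2\<in>T. (\<forall>z\<in>W. proj z = w1 \<longrightarrow> bad_labels z = bad_labels x) \<longrightarrow>
          (\<forall>z\<in>W. proj z = w2 \<longrightarrow> bad_labels z = bad_labels x)"
        by blast
      moreover have "openin (top_of_set V) T"
        unfolding T_def by (intro openin_open_Int open_proj open_Int open_ball W)
      moreover have "w \<in> T"
        using \<open>w \<in> V\<close> p e(1) by (auto simp: T_def)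
      ultimately show "\<exists>T. openin (top_of_set V) T \<and> w \<in> T \<and>
          (\<forall>w1\<in>T. \<forall>w2\<in>T. (\<forall>z\<in>W. proj z = w1 \<longrightarrow> bad_labels z = bad_labels x) \<longrightarrow>
            (\<forall>z\<in>W. proj z = w2 \<longrightarrow> bad_labels z = bad_labels x))"
        by (intro exI[of _ T] conjI)
    qed
    then show ?thesis
      using y by auto
  qed
  have "(\<chi> i. 1 / 2) \<in> W"
    unfolding W_def mem_Collect_eq generic_fl_iff by simp
  then have "W \<noteq> {}"
    by blast
  then obtain p where p: "p \<in> W" "p \<notin> doubly_singular"
    using open_not_doubly_singular[OF W(1)] by blast
  show thesis
  proof (rule that)
    fix x assume x: "generic x" "x \<notin> doubly_singular"
    have "x + ivec (- fl x) \<in> W - doubly_singular"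
      using x doubly_singular_flow_iff[of x 0] by (simp add: W_def)
    then show "bad_labels x = bad_labels p"
      using const[of "x + ivec (- fl x)" p] p by simp
  qed
qed

lemma contradiction: False
proof -
  obtain D where D: "\<And>x. generic x \<Longrightarrow> x \<notin> doubly_singular \<Longrightarrow> bad_labels x = D"
    by (rule bad_labels_constant) (rule that; assumption)
  obtain p where p: "p \<in> U" "p \<notin> doubly_singular"
    using open_not_doubly_singular[OF U(1,2)] by blast
  have cell_U: "generic y \<and> fl y = 0" if "y \<in> U" for y
    using that U(3) cell_eq_box[of 0] by auto
  have pD: "bad_labels p = D"
    using D p cell_U by blast
  have "R i ` D = D" for i
  proof -
    \<comment> \<open>The crossing takes place on a line that is not doubly singular, so the label
      set is \<open>D\<close> on both sides of the face.\<close>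
    obtain q where q: "q $ i \<in> \<int>" "\<And>j. j \<noteq> i \<Longrightarrow> q $ j \<notin> \<int>" "q \<notin> doubly_singular"
      by (rule face_point[of i]) (rule that; assumption)
    obtain s where s: "s > 0" "generic (q - s *\<^sub>R u)" "generic (q + s *\<^sub>R u)"
      "fl (q + s *\<^sub>R u) = fl (q - s *\<^sub>R u) + exit_vec u i"
      using face_crossing[OF u_nonzero q(1,2)] by blast
    have eq: "q - s *\<^sub>R u + (2 * s) *\<^sub>R u = q + s *\<^sub>R u"
      by (simp add: algebra_simps flip: scaleR_2)
    have "q + s *\<^sub>R u \<notin> doubly_singular" "q - s *\<^sub>R u \<notin> doubly_singular"
      using q(3) doubly_singular_flow_iff[of q s 0] doubly_singular_flow_iff[of q "- s" 0]
      by simp_all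
    then have "bad_labels (q + s *\<^sub>R u) = D" "bad_labels (q - s *\<^sub>R u) = D"
      using D s by simp_all
    then show ?thesis
      using bad_labels_flow(2)[of "q - s *\<^sub>R u" "2 * s" i] s unfolding eq by simp
  qed
  moreover have "D \<subseteq> C" "D \<noteq> {}"
    using bad_labels_subset[of p] bad_labels_nonempty[of p] cell_U p(1) pD by auto
  ultimately have "D = C"
    by (intro transitive)
  then have gp: "g \<in> bad_labels p"
    using g pD by simp
  obtain e where e: "e > 0" "ball p e \<subseteq> U"
    using U(1) p(1) open_contains_ball by blast
  \<comment> \<open>A window of length 0 is enough: at time 0 the trajectory already carries
    \<open>g\<close> at a point of \<open>U\<close>.\<close>
  obtain y where "dist p y < e" and bad_y: "bad 0 y g"
    using gp e(1) by (rule bad_labelsE)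
  then have y: "y \<in> U"
    using e(2) by auto
  obtain k where "avoids y k 0 0" "k 0 = g"
    using bad_y by (auto simp: bad_def)
  then show False
    using cell_U[OF y] y by (auto simp: avoids_def)
qed

end

lemma (in cell_flow) uniform_visits:
  assumes "g \<in> C" "open U" "U \<noteq> {}" "U \<subseteq> box 0 1"
  obtains T where "T > 0" "\<And>x k a. trajectory x k a (a + T) \<Longrightarrow>
    \<exists>s. a \<le> s \<and> s \<le> a + T \<and> generic (x + s *\<^sub>R u) \<and> k s = g \<and>
      x + s *\<^sub>R u - ivec (fl (x + s *\<^sub>R u)) \<in> U"
proof (rule ccontr)
  assume neg: "\<not> thesis"
  note hyp = that
  have *: "\<exists>x k a. trajectory x k a (a + T) \<and> (\<forall>s. a \<le> s \<and> s \<le> a + T \<longrightarrow>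
    \<not> (generic (x + s *\<^sub>R u) \<and> k s = g \<and> x + s *\<^sub>R u - ivec (fl (x + s *\<^sub>R u)) \<in> U))"
    if "T > 0" for T
    using neg hyp[OF that] by blast
  have "\<exists>x k. trajectory x k (- N) N \<and> (\<forall>s. - N \<le> s \<and> s \<le> N \<longrightarrow>
    \<not> (generic (x + s *\<^sub>R u) \<and> k s = g \<and> x + s *\<^sub>R u - ivec (fl (x + s *\<^sub>R u)) \<in> U))" for N
  proof -
    \<comment> \<open>The denied bound concerns positive lengths, while \<open>N\<close> may be
      negative; the interval of length \<open>2 * M\<close> is recentred at its midpoint.\<close>
    define M where "M = max N 1"
    obtain x k a where xk: "trajectory x k a (a + 2 * M)"
      "\<And>s. a \<le> s \<and> s \<le> a + 2 * M \<Longrightarrow>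
        \<not> (generic (x + s *\<^sub>R u) \<and> k s = g \<and> x + s *\<^sub>R u - ivec (fl (x + s *\<^sub>R u)) \<in> U)"
      using *[of "2 * M"] by (force simp: M_def)
    have M: "M \<ge> N"
      by (simp add: M_def)
    have eq: "x + (a + M) *\<^sub>R u + ivec 0 + s *\<^sub>R u = x + (s + (a + M)) *\<^sub>R u" for s
      by (simp add: algebra_simps)
    have "trajectory (x + (a + M) *\<^sub>R u + ivec 0) (\<lambda>s. k (s + (a + M))) (- N) N"
      by (rule trajectory_shift[OF xk(1)]) (use M in auto)
    moreover have "\<not> (generic (x + (s + (a + M)) *\<^sub>R u) \<and> k (s + (a + M)) = g \<and>
        x + (s + (a + M)) *\<^sub>R u - ivec (fl (x + (s + (a + M)) *\<^sub>R u)) \<in> U)"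
      if "- N \<le> s \<and> s \<le> N" for s
      by (rule xk(2)) (use M that in auto)
    ultimately show ?thesis
      unfolding eq[symmetric] by blast
  qed
  then interpret missed_set C R u g U
    by unfold_locales (use assms in auto)
  show False
    by (rule contradiction)
qed

section \<open>Geodesics as trajectories\<close>

lemma exit_vec_eq: "exit_vec u i = (if u $ i > 0 then unit_e i else - unit_e i)"
  by (simp add: exit_vec_def unit_e_def vec_eq_iff axis_def)

definition face_perm :: "(int^3) set \<Rightarrow> (3 \<Rightarrow> int^3 \<Rightarrow> int^3) \<Rightarrow> 3 \<Rightarrow> int^3 \<Rightarrow> int^3" where
  "face_perm C \<sigma> i c = (if c + unit_e i \<in> C then c + unit_e i else \<sigma> i c)"

text \<open>\<open>face_perm\<close> describes upward crossings; a direction with negative component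
  crosses the same faces the other way, whence the inverse.\<close>

definition exit_perm ::
  "(int^3) set \<Rightarrow> (3 \<Rightarrow> int^3 \<Rightarrow> int^3) \<Rightarrow> real^3 \<Rightarrow> 3 \<Rightarrow> int^3 \<Rightarrow> int^3" where
  "exit_perm C \<sigma> u i = (if u $ i > 0 then face_perm C \<sigma> i else inv_into C (face_perm C \<sigma> i))"

text \<open>Interior crossings match the cubes with an upper neighbour to those with a lower
  neighbour, and the pairing matches the complements \<open>top_cubes\<close> and
  \<open>bot_cubes\<close>.\<close>

lemma bij_face_perm:
  assumes "face_pairing C \<sigma>"
  shows "bij_betw (face_perm C \<sigma> i) C C"
proof -
  have "bij_betw (face_perm C \<sigma> i) {c \<in> C. c + unit_e i \<in> C} {d \<in> C. d - unit_e i \<in> C}"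
    by (rule bij_betwI[where g = "\<lambda>d. d - unit_e i"]) (auto simp: face_perm_def)
  moreover have "bij_betw (face_perm C \<sigma> i) (top_cubes C i) (bot_cubes C i)"
    using assms unfolding face_pairing_def
    by (subst bij_betw_cong[where g = "\<sigma> i"]) (auto simp: face_perm_def top_cubes_def)
  moreover have "{d \<in> C. d - unit_e i \<in> C} \<inter> bot_cubes C i = {}"
    by (auto simp: bot_cubes_def)
  ultimately have "bij_betw (face_perm C \<sigma> i) ({c \<in> C. c + unit_e i \<in> C} \<union> top_cubes C i)
      ({d \<in> C. d - unit_e i \<in> C} \<union> bot_cubes C i)"
    by (rule bij_betw_combine)
  moreover have "{c \<in> C. c + unit_e i \<in> C} \<union> top_cubes C i = C"
    "{d \<in> C. d - unit_e i \<in> C} \<union> bot_cubes C i = C"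
    by (auto simp: top_cubes_def bot_cubes_def)
  ultimately show ?thesis
    by simp
qed

lemma bij_exit_perm:
  assumes "face_pairing C \<sigma>"
  shows "bij_betw (exit_perm C \<sigma> u i) C C"
  using bij_face_perm[OF assms] bij_betw_inv_into by (auto simp: exit_perm_def)

lemma inv_face_perm:
  assumes "face_pairing C \<sigma>" "c \<in> C" "face_perm C \<sigma> i c = d"
  shows "inv_into C (face_perm C \<sigma> i) d = c"
  using bij_betw_inv_into_left[OF bij_face_perm[OF assms(1)] assms(2)] assms(3) by metis

lemma exit_perm_inside:
  assumes "face_pairing C \<sigma>" "c \<in> C" "c + exit_vec u i \<in> C"
  shows "exit_perm C \<sigma> u i c = c + exit_vec u i"
proof (cases "u $ i > 0")
  case True
  then show ?thesis
    using assms by (simp add: exit_perm_def face_perm_def exit_vec_eq)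
next
  case False
  then have "c - unit_e i \<in> C" "face_perm C \<sigma> i (c - unit_e i) = c"
    using assms by (simp_all add: face_perm_def exit_vec_eq)
  from inv_face_perm[OF assms(1) this] show ?thesis
    using False by (simp add: exit_perm_def exit_vec_eq)
qed

lemma exit_perm_top: "u $ i > 0 \<Longrightarrow> c \<in> top_cubes C i \<Longrightarrow> exit_perm C \<sigma> u i c = \<sigma> i c"
  by (simp add: exit_perm_def face_perm_def top_cubes_def)

lemma exit_perm_bot:
  assumes "face_pairing C \<sigma>" "\<not> u $ i > 0" "a \<in> top_cubes C i"
  shows "exit_perm C \<sigma> u i (\<sigma> i a) = a"
proof -
  have "a \<in> C" "face_perm C \<sigma> i a = \<sigma> i a"
    using assms(3) by (simp_all add: face_perm_def top_cubes_def)
  from inv_face_perm[OF assms(1) this] show ?thesis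
    using assms(2) by (simp add: exit_perm_def)
qed

text \<open>Invariance under an inverse permutation is invariance under the permutation itself, so
  the signs of \<open>u\<close> disappear. A step to a lower neighbour stays in \<open>D\<close>
  because that neighbour is the only preimage of the cube.\<close>

lemma exit_perm_transitive:
  assumes C: "polycube_region C" and fp: "face_pairing C \<sigma>"
    and D: "D \<subseteq> C" "D \<noteq> {}" "\<And>i. exit_perm C \<sigma> u i ` D = D"
  shows "D = C"
proof -
  have P: "face_perm C \<sigma> i ` D = D" for i
  proof (cases "u $ i > 0")
    case True
    then show ?thesis
      using D(3)[of i] by (simp add: exit_perm_def)
  next
    case False
    then have "inv_into C (face_perm C \<sigma> i) ` D = D"
      using D(3)[of i] by (simp add: exit_perm_def)
    then show ?thesis
      using image_inv_into_cancel[OF bij_betw_imp_surj_on[OF bij_face_perm[OF fp, of i]] D(1)]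
      by simp
  qed
  have step: "d \<in> D" if cD: "c \<in> D" and adj: "face_adj C c d" for c d
  proof -
    have cd: "c \<in> C" "d \<in> C"
      using adj by (auto simp: face_adj_def)
    obtain i where "d = c + unit_e i \<or> d = c - unit_e i"
      using adj by (auto simp: face_adj_def)
    then show ?thesis
    proof
      assume "d = c + unit_e i"
      then have "d = face_perm C \<sigma> i c"
        using cd by (simp add: face_perm_def)
      then show ?thesis
        using P[of i] cD by blast
    next
      assume "d = c - unit_e i"
      then have "face_perm C \<sigma> i d = c"
        using cd by (simp add: face_perm_def)
      moreover obtain d' where "d' \<in> D" "face_perm C \<sigma> i d' = c"
        using P[of i] cD by (metis imageE)
      ultimately show ?thesis
        using inv_face_perm[OF fp] cd D(1) by (metis subsetD)
    qed
  qed
  obtain c where c: "c \<in> D"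
    using D(2) by blast
  have "d \<in> D" if "d \<in> C" for d
  proof -
    have "(face_adj C)\<^sup>*\<^sup>* c d"
      using C c D(1) that by (auto simp: polycube_region_def)
    then show ?thesis
      by (induction rule: rtranclp_induct) (use c step in auto)
  qed
  then show ?thesis
    using D(1) by blast
qed

text \<open>The relative interior of the face through which direction \<open>u\<close> leaves the
  cell \<open>c\<close>; this cell may lie outside the region.\<close>

definition at_exit :: "real^3 \<Rightarrow> 3 \<Rightarrow> real^3 \<Rightarrow> int^3 \<Rightarrow> bool" where
  "at_exit u i q c \<longleftrightarrow>
    (\<forall>j. j \<noteq> i \<longrightarrow> of_int (c $ j) < q $ j \<and> q $ j < of_int (c $ j) + 1) \<and>
    q $ i = of_int (c $ i) + (if u $ i > 0 then 1 else 0)"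

lemma at_exit_add_ivec: "at_exit u i q c \<Longrightarrow> at_exit u i (q + ivec z) (c + z)"
  by (simp add: at_exit_def)

lemma at_exit_not_Ints:
  assumes "at_exit u i q c" "j \<noteq> i"
  shows "q $ j \<notin> \<int>"
proof
  assume "q $ j \<in> \<int>"
  then obtain k where "q $ j = of_int k"
    by (auto elim: Ints_cases)
  then have "of_int (c $ j) < (of_int k :: real)" "of_int k < (of_int (c $ j) + 1 :: real)"
    using assms by (auto simp: at_exit_def)
  then have "c $ j < k" "k < c $ j + 1"
    by linarith+
  then show False
    by simp
qed

lemma atomic_cube_at_exit:
  assumes "at_exit u i q c" "q \<in> atomic_cube a" "j \<noteq> i"
  shows "a $ j = c $ j"
proof -
  have "of_int (c $ j) < q $ j" "q $ j < of_int (c $ j) + 1"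
    "of_int (a $ j) \<le> q $ j" "q $ j \<le> of_int (a $ j) + 1"
    using assms by (auto simp: at_exit_def atomic_cube_def)
  then show ?thesis
    by linarith
qed

text \<open>A relative interior point of a face belongs to just two closed cells, and the sign of
  \<open>u $ i\<close> tells which of them has it on its upper face.\<close>

lemma top_face_at_exit:
  assumes "at_exit u i q c" "q \<in> top_face a j"
  shows "j = i" and "a = (if u $ i > 0 then c else c - unit_e i)"
proof -
  have q: "q \<in> atomic_cube a" "q $ j = of_int (a $ j) + 1"
    using assms(2) by (auto simp: top_face_def)
  then have "q $ j \<in> \<int>"
    by simp
  then show "j = i"
    using at_exit_not_Ints[OF assms(1)] by blast
  then have "real_of_int (a $ i) + 1 = of_int (c $ i) + (if u $ i > 0 then 1 else 0)"
    using q(2) assms(1) by (simp add: at_exit_def)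
  then have "a $ i = c $ i + (if u $ i > 0 then 0 else - 1)"
    by (cases "u $ i > 0") simp_all
  then have "a $ j = (if u $ i > 0 then c else c - unit_e i) $ j" for j
    using atomic_cube_at_exit[OF assms(1) q(1), of j]
    by (cases "j = i") (simp_all add: unit_e_def axis_def)
  then show "a = (if u $ i > 0 then c else c - unit_e i)"
    unfolding vec_eq_iff by blast
qed

lemma bot_face_at_exit:
  assumes "at_exit u i q c" "q \<in> bot_face a j"
  shows "j = i" and "a = (if u $ i > 0 then c + unit_e i else c)"
proof -
  have q: "q \<in> atomic_cube a" "q $ j = of_int (a $ j)"
    using assms(2) by (auto simp: bot_face_def)
  then have "q $ j \<in> \<int>"
    by simp
  then show "j = i"
    using at_exit_not_Ints[OF assms(1)] by blast
  then have "real_of_int (a $ i) = of_int (c $ i) + (if u $ i > 0 then 1 else 0)"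
    using q(2) assms(1) by (simp add: at_exit_def)
  then have "a $ i = c $ i + (if u $ i > 0 then 1 else 0)"
    by (cases "u $ i > 0") simp_all
  then have "a $ j = (if u $ i > 0 then c + unit_e i else c) $ j" for j
    using atomic_cube_at_exit[OF assms(1) q(1), of j]
    by (cases "j = i") (simp_all add: unit_e_def axis_def)
  then show "a = (if u $ i > 0 then c + unit_e i else c)"
    unfolding vec_eq_iff by blast
qed

text \<open>Since \<open>q\<close> lies on no edge, only the gluing of its own face applies, and its
  translation carries the cell beyond the face to the cube
  \<open>exit_perm C \<sigma> u i c\<close>.\<close>

lemma geo_step_exit:
  assumes fp: "face_pairing C \<sigma>" and q: "at_exit u i q c" and step: "geo_step C \<sigma> u q p"
  shows "p = q \<or> p = q + ivec (exit_perm C \<sigma> u i c - c - exit_vec u i)"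
proof (cases "p = q")
  case False
  then obtain j a where a: "a \<in> top_cubes C j"
    "u $ j > 0 \<and> q \<in> top_face a j \<and> p = q + shift \<sigma> j a \<or>
     u $ j < 0 \<and> q \<in> bot_face (\<sigma> j a) j \<and> p = q - shift \<sigma> j a"
    using step by (auto simp: geo_step_def)
  from a(2) show ?thesis
  proof (elim disjE conjE)
    assume *: "u $ j > 0" "q \<in> top_face a j" "p = q + shift \<sigma> j a"
    have "j = i" "a = c"
      using top_face_at_exit[OF q *(2)] *(1) by auto
    then show ?thesis
      using * a(1) exit_perm_top[of u i c C \<sigma>] by (simp add: shift_def exit_vec_eq)
  next
    assume *: "u $ j < 0" "q \<in> bot_face (\<sigma> j a) j" "p = q - shift \<sigma> j a"
    have j: "j = i" and c: "\<sigma> i a = c"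
      using bot_face_at_exit[OF q *(2)] *(1) by auto
    have "exit_perm C \<sigma> u i c = a"
      using exit_perm_bot[OF fp, of u i a] *(1) a(1) j c by simp
    moreover have "ivec (a - c - exit_vec u i) = - ivec (c - a - unit_e i)"
      using *(1) j by (simp add: exit_vec_eq vec_eq_iff)
    ultimately show ?thesis
      using *(3) j c by (simp add: shift_def)
  qed
qed simp

text \<open>Pieces may have length zero, so several transitions can occur at one instant. After a
  jump the point lies on the entry face of the glued cube; a second jump would require a cube behind
  this face, where \<open>C\<close> has none.\<close>

lemma geo_step_entry:
  assumes fp: "face_pairing C \<sigma>" and c: "c \<in> C" "c + exit_vec u i \<notin> C"
    and q: "at_exit u i q (exit_perm C \<sigma> u i c - exit_vec u i)" and step: "geo_step C \<sigma> u q p"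
  shows "p = q"
proof (rule ccontr)
  assume "p \<noteq> q"
  then obtain j a where a: "a \<in> top_cubes C j"
    "u $ j > 0 \<and> q \<in> top_face a j \<or> u $ j < 0 \<and> q \<in> bot_face (\<sigma> j a) j"
    using step by (auto simp: geo_step_def)
  have bij: "bij_betw (\<sigma> i) (top_cubes C i) (bot_cubes C i)"
    using fp by (simp add: face_pairing_def)
  from a(2) show False
  proof (elim disjE conjE)
    assume *: "u $ j > 0" "q \<in> top_face a j"
    have ji: "j = i"
      by (rule top_face_at_exit[OF q *(2)])
    then have "a = exit_perm C \<sigma> u i c - unit_e i"
      using top_face_at_exit(2)[OF q *(2)] *(1) by (simp add: exit_vec_eq)
    moreover have "c \<in> top_cubes C i"
      using c *(1) ji by (simp add: top_cubes_def exit_vec_eq)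
    ultimately have "\<sigma> i c - unit_e i \<in> C" "\<sigma> i c \<in> bot_cubes C i"
      using a(1) *(1) ji bij exit_perm_top[of u i c C \<sigma>] by (auto simp: top_cubes_def bij_betw_def)
    then show False
      by (simp add: bot_cubes_def)
  next
    assume *: "u $ j < 0" "q \<in> bot_face (\<sigma> j a) j"
    have ji: "j = i"
      by (rule bot_face_at_exit[OF q *(2)])
    then have \<sigma>a: "\<sigma> i a = exit_perm C \<sigma> u i c + unit_e i"
      using bot_face_at_exit(2)[OF q *(2)] *(1) by (simp add: exit_vec_eq)
    have "c \<in> bot_cubes C i"
      using c *(1) ji by (simp add: bot_cubes_def exit_vec_eq)
    then obtain a' where a': "a' \<in> top_cubes C i" "c = \<sigma> i a'"
      using bij by (auto simp: bij_betw_def)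
    then have "\<sigma> i a = a' + unit_e i"
      using \<sigma>a exit_perm_bot[OF fp, of u i a'] *(1) ji by simp
    moreover have "\<sigma> i a \<in> bot_cubes C i"
      using bij a(1) ji by (auto simp: bij_betw_def)
    ultimately show False
      using a'(1) by (simp add: bot_cubes_def top_cubes_def)
  qed
qed

lemma geo_step_generic:
  assumes "generic q" "geo_step C \<sigma> u q p"
  shows "p = q"
proof -
  have "q \<notin> top_face a j" for a j
    using assms(1) by (auto simp: generic_def top_face_def dest!: spec[of _ j])
  moreover have "q \<notin> bot_face a j" for a j
    using assms(1) by (auto simp: generic_def bot_face_def dest!: spec[of _ j])
  ultimately show ?thesis
    using assms(2) by (auto simp: geo_step_def)
qed

lemma generic_region:
  assumes "generic y" "y \<in> region C"
  shows "fl y \<in> C"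
proof -
  obtain c where c: "c \<in> C" "y \<in> atomic_cube c"
    using assms(2) by (auto simp: region_def)
  have "c $ j = fl y $ j" for j
  proof -
    have "of_int (c $ j) \<le> y $ j" "y $ j \<le> of_int (c $ j) + 1"
      using c(2) by (auto simp: atomic_cube_def)
    moreover have "of_int \<lfloor>y $ j\<rfloor> < y $ j" "y $ j < of_int \<lfloor>y $ j\<rfloor> + 1"
      using assms(1) by (auto simp: generic_def simp flip: not_Ints_iff_floor)
    ultimately show ?thesis
      by simp linarith
  qed
  then have "c = fl y"
    by (simp add: vec_eq_iff)
  then show ?thesis
    using c(1) by simp
qed

section \<open>Passage of a line from one cell to the next\<close>

lemma affine_between:
  fixes a w r s t lo hi :: real
  assumes "s \<le> r" "r \<le> t" "lo < a + s * w" "a + s * w < hi" "lo < a + t * w" "a + t * w < hi"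
  shows "lo < a + r * w" "a + r * w < hi"
proof -
  consider "s * w \<le> r * w" "r * w \<le> t * w" | "t * w \<le> r * w" "r * w \<le> s * w"
    using assms(1,2) by (meson linorder_le_cases mult_right_mono mult_right_mono_neg)
  then show "lo < a + r * w" "a + r * w < hi"
    using assms(3-6) by (cases; linarith)+
qed

lemma cell_between:
  assumes "generic (x + s *\<^sub>R u)" "fl (x + s *\<^sub>R u) = n" "generic (x + t *\<^sub>R u)" "fl (x + t *\<^sub>R u) = n"
    and "s \<le> r" "r \<le> t"
  shows "generic (x + r *\<^sub>R u) \<and> fl (x + r *\<^sub>R u) = n"
proof -
  have s: "of_int (n $ j) < x $ j + s * u $ j" "x $ j + s * u $ j < of_int (n $ j) + 1" for j
    using assms(1,2) generic_fl_iff[of "x + s *\<^sub>R u" n] by simp_all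
  have t: "of_int (n $ j) < x $ j + t * u $ j" "x $ j + t * u $ j < of_int (n $ j) + 1" for j
    using assms(3,4) generic_fl_iff[of "x + t *\<^sub>R u" n] by simp_all
  show ?thesis
    unfolding generic_fl_iff using affine_between[OF assms(5,6) s t] by simp
qed

text \<open>The coordinate \<open>i\<close> is strictly monotone in time and takes the value of the
  face once, while the other coordinates stay in their open unit intervals. So no edge is met
  between \<open>s\<close> and \<open>t\<close>.\<close>

lemma exit_time:
  assumes s: "generic (x + s *\<^sub>R u)" "fl (x + s *\<^sub>R u) = n"
    and t: "generic (x + t *\<^sub>R u)" "fl (x + t *\<^sub>R u) = n + exit_vec u i"
    and st: "s \<le> t" and u: "u $ i \<noteq> 0"
  obtains r where "s < r" "r < t" "at_exit u i (x + r *\<^sub>R u) n"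
    "\<And>r'. s \<le> r' \<Longrightarrow> r' < r \<Longrightarrow> generic (x + r' *\<^sub>R u) \<and> fl (x + r' *\<^sub>R u) = n"
    "\<And>r'. r < r' \<Longrightarrow> r' \<le> t \<Longrightarrow> generic (x + r' *\<^sub>R u) \<and> fl (x + r' *\<^sub>R u) = n + exit_vec u i"
proof -
  define b where "b = real_of_int (n $ i) + (if u $ i > 0 then 1 else 0)"
  define r where "r = (b - x $ i) / u $ i"
  have r: "x $ i + r * u $ i = b"
    using u by (simp add: r_def)
  have S: "of_int (n $ j) < x $ j + s * u $ j" "x $ j + s * u $ j < of_int (n $ j) + 1" for j
    using s generic_fl_iff[of "x + s *\<^sub>R u" n] by simp_all
  have T: "of_int (n $ j + exit_vec u i $ j) < x $ j + t * u $ j"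
    "x $ j + t * u $ j < of_int (n $ j + exit_vec u i $ j) + 1" for j
    using t generic_fl_iff[of "x + t *\<^sub>R u" "n + exit_vec u i"] by simp_all
  have e: "exit_vec u i $ j = 0" if "j \<noteq> i" for j
    using that by (simp add: exit_vec_def axis_def)
  have ei: "exit_vec u i $ i = (if u $ i > 0 then 1 else - 1)"
    by (simp add: exit_vec_def)
  have T': "of_int (n $ j) < x $ j + t * u $ j" "x $ j + t * u $ j < of_int (n $ j) + 1"
    if "j \<noteq> i" for j
    using T[of j] e[OF that] by simp_all
  have mono: "x $ i + r1 * u $ i < x $ i + r2 * u $ i \<longleftrightarrow> (if u $ i > 0 then r1 < r2 else r2 < r1)"
    for r1 r2
    using u by (auto simp: mult_less_cancel_right)
  have "s < r" "r < t"
    using mono[of s r] mono[of r s] mono[of t r] mono[of r t] S[of i] T[of i] u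
    unfolding r by (auto simp: b_def ei split: if_splits)
  have other: "of_int (n $ j) < x $ j + r' * u $ j" "x $ j + r' * u $ j < of_int (n $ j) + 1"
    if "j \<noteq> i" "s \<le> r'" "r' \<le> t" for j r'
    using affine_between[OF that(2,3) S[of j] T'[OF that(1)]] by auto
  show thesis
  proof (rule that[OF \<open>s < r\<close> \<open>r < t\<close>])
    show "at_exit u i (x + r *\<^sub>R u) n"
      using other \<open>s < r\<close> \<open>r < t\<close> r by (auto simp: at_exit_def b_def)
  next
    fix r' assume r': "s \<le> r'" "r' < r"
    have "of_int (n $ i) < x $ i + r' * u $ i" "x $ i + r' * u $ i < of_int (n $ i) + 1"
      using mult_right_mono[of s r' "u $ i"] mult_strict_right_mono[of r' r "u $ i"]
        mult_right_mono_neg[of s r' "u $ i"] mult_strict_right_mono_neg[of r' r "u $ i"]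
        S[of i] r r' u by (cases "u $ i > 0"; simp add: b_def; linarith)+
    then have "of_int (n $ j) < x $ j + r' * u $ j \<and> x $ j + r' * u $ j < of_int (n $ j) + 1" for j
      using other[of j r'] r' \<open>r < t\<close> by (cases "j = i") auto
    then show "generic (x + r' *\<^sub>R u) \<and> fl (x + r' *\<^sub>R u) = n"
      unfolding generic_fl_iff by simp
  next
    fix r' assume r': "r < r'" "r' \<le> t"
    have "of_int (n $ i + exit_vec u i $ i) < x $ i + r' * u $ i"
      "x $ i + r' * u $ i < of_int (n $ i + exit_vec u i $ i) + 1"
      using mult_right_mono[of r' t "u $ i"] mult_strict_right_mono[of r r' "u $ i"]
        mult_right_mono_neg[of r' t "u $ i"] mult_strict_right_mono_neg[of r r' "u $ i"]
        T[of i] r r' u by (cases "u $ i > 0"; simp add: b_def ei; linarith)+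
    then have "of_int (n $ j + exit_vec u i $ j) < x $ j + r' * u $ j \<and>
        x $ j + r' * u $ j < of_int (n $ j + exit_vec u i $ j) + 1" for j
      using other[of j r'] e[of j] r' \<open>s < r\<close> by (cases "j = i") auto
    then show "generic (x + r' *\<^sub>R u) \<and> fl (x + r' *\<^sub>R u) = n + exit_vec u i"
      unfolding generic_fl_iff by simp
  qed
qed

text \<open>A geodesic segment straightened to the line through x in direction u: during the times from
  \<open>T k\<close> to \<open>T (Suc k)\<close> it differs from this line by the integer translation \<open>w k\<close>.\<close>

locale straightened =
  fixes C :: "(int^3) set" and \<sigma> :: "3 \<Rightarrow> int^3 \<Rightarrow> int^3" and u x :: "real^3"
    and T :: "nat \<Rightarrow> real" and w :: "nat \<Rightarrow> int^3" and n :: nat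
  assumes fp: "face_pairing C \<sigma>"
    and u_nz: "u $ i \<noteq> 0"
    and n_pos: "n > 0"
    and T_0: "T 0 = 0"
    and T_Suc: "k < n \<Longrightarrow> T k \<le> T (Suc k)"
    and in_region: "k < n \<Longrightarrow> T k \<le> t \<Longrightarrow> t \<le> T (Suc k) \<Longrightarrow> x + t *\<^sub>R u + ivec (w k) \<in> region C"
    and step: "Suc k < n \<Longrightarrow>
      geo_step C \<sigma> u (x + T (Suc k) *\<^sub>R u + ivec (w k)) (x + T (Suc k) *\<^sub>R u + ivec (w (Suc k)))"
begin

section \<open>Offsets along a straightened geodesic\<close>

lemma T_mono: "k \<le> l \<Longrightarrow> l \<le> n \<Longrightarrow> T k \<le> T l"
proof (induction l rule: dec_induct)
  case (step l)
  then show ?case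
    using T_Suc[of l] by simp
qed simp

lemma ivec_inj: "ivec a = ivec b \<Longrightarrow> a = b"
  by (simp add: vec_eq_iff)

lemma offset_step_generic:
  assumes "Suc k < n" "generic (x + T (Suc k) *\<^sub>R u)"
  shows "w (Suc k) = w k"
  using geo_step_generic[OF _ step[OF assms(1)]] assms(2) ivec_inj by simp

lemma label_in_C:
  assumes "k < n" "T k \<le> t" "t \<le> T (Suc k)" "generic (x + t *\<^sub>R u)"
  shows "fl (x + t *\<^sub>R u) + w k \<in> C"
  using generic_region[OF _ in_region[OF assms(1-3)]] assms(4) by simp

text \<open>The line stays in one open cell from \<open>s\<close> to \<open>t\<close>, so each piece
  boundary in between is generic, where no jump is possible.\<close>

lemma same_offset:
  assumes k: "k < n" "T k \<le> s" "s \<le> T (Suc k)" and l: "l < n" "T l \<le> t" "t \<le> T (Suc l)"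
    and st: "s \<le> t" "k \<le> l"
    and g: "generic (x + s *\<^sub>R u)" "generic (x + t *\<^sub>R u)" "fl (x + t *\<^sub>R u) = fl (x + s *\<^sub>R u)"
  shows "w l = w k"
proof -
  have "m \<le> l \<Longrightarrow> w m = w k" if "k \<le> m" for m
    using that
  proof (induction m rule: dec_induct)
    case (step m)
    have "s \<le> T (Suc m)" "T (Suc m) \<le> t"
      using T_mono[of "Suc k" "Suc m"] T_mono[of "Suc m" l] step k l by auto
    then have "generic (x + T (Suc m) *\<^sub>R u)"
      using cell_between[OF g(1) refl g(2,3)] by blast
    then show ?case
      using offset_step_generic[of m] step l by simp
  qed simp
  then show ?thesis
    using st(2) by blast
qed

text \<open>Several piece boundaries may fall on the crossing time \<open>r\<close>, with or without
  a jump. Only the old offset \<open>w k\<close> and the glued offset \<open>w'\<close> can occur,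
  and after \<open>r\<close> the old one would put the geodesic outside the region unless both
  agree.\<close>

lemma crossing_offset:
  assumes k: "k < n" "T k \<le> s" "s \<le> T (Suc k)" and l: "l < n" "T l \<le> t" "t \<le> T (Suc l)"
    and st: "s \<le> t" "k \<le> l"
    and g: "generic (x + s *\<^sub>R u)" "generic (x + t *\<^sub>R u)"
    and cross: "fl (x + t *\<^sub>R u) = fl (x + s *\<^sub>R u) + exit_vec u i"
  shows "fl (x + t *\<^sub>R u) + w l = exit_perm C \<sigma> u i (fl (x + s *\<^sub>R u) + w k)"
proof -
  define N where "N = fl (x + s *\<^sub>R u)"
  define c where "c = N + w k"
  \<comment> \<open>The offset that places the geodesic in the cube prescribed by
    \<open>exit_perm\<close> once the line is in the next cell.\<close>
  define w' where "w' = exit_perm C \<sigma> u i c - (N + exit_vec u i)"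
  obtain r where r: "s < r" "r < t" "at_exit u i (x + r *\<^sub>R u) N"
    "\<And>r'. s \<le> r' \<Longrightarrow> r' < r \<Longrightarrow> generic (x + r' *\<^sub>R u) \<and> fl (x + r' *\<^sub>R u) = N"
    "\<And>r'. r < r' \<Longrightarrow> r' \<le> t \<Longrightarrow> generic (x + r' *\<^sub>R u) \<and> fl (x + r' *\<^sub>R u) = N + exit_vec u i"
    by (rule exit_time[OF g(1) N_def[symmetric] g(2) cross[folded N_def] st(1) u_nz]) blast
  have c: "c \<in> C"
    using label_in_C[OF k g(1)] by (simp add: c_def N_def)
  have inside: "w k = w'" if "c + exit_vec u i \<in> C"
    using exit_perm_inside[OF fp c that] by (simp add: w'_def c_def)
  have after: "w m = w'"
    if "m < n" "T m \<le> r'" "r' \<le> T (Suc m)" "r < r'" "r' \<le> t" "w m = w k \<or> w m = w'" for m r'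
  proof (cases "w m = w'")
    case False
    then have "N + exit_vec u i + w k \<in> C"
      using label_in_C[OF that(1-3)] r(5)[OF that(4,5)] that(6) by auto
    then show ?thesis
      using inside False that(6) by (simp add: c_def add.commute add.left_commute)
  qed
  have inv: "m \<le> l \<Longrightarrow> (w m = w k \<or> w m = w') \<and> (T m < r \<longrightarrow> w m = w k) \<and> (r < T m \<longrightarrow> w m = w')"
    if "k \<le> m" for m
    using that
  proof (induction m rule: dec_induct)
    case base
    then show ?case
      using k(2) r(1) by auto
  next
    case (step m)
    have m: "m < n" "Suc m < n"
      using step l by auto
    have IH: "w m = w k \<or> w m = w'" "T m < r \<Longrightarrow> w m = w k" "r < T m \<Longrightarrow> w m = w'"
      using step by auto
    have T: "s \<le> T (Suc m)" "T (Suc m) \<le> t" "T m \<le> T (Suc m)"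
      using T_mono[of "Suc k" "Suc m"] T_mono[of "Suc m" l] T_Suc[of m] step k l by auto
    consider "T (Suc m) < r" | "T (Suc m) = r" | "r < T (Suc m)"
      by linarith
    then show ?case
    proof cases
      case 1
      then have "w (Suc m) = w m"
        using offset_step_generic[OF m(2)] r(4)[OF T(1)] by blast
      then show ?thesis
        using IH 1 T(3) by auto
    next
      case 3
      then have "w (Suc m) = w m"
        using offset_step_generic[OF m(2)] r(5)[OF _ T(2)] by blast
      moreover have "w m = w'"
        by (rule after[OF m(1) T(3) order_refl 3 T(2) IH(1)])
      ultimately show ?thesis
        using 3 by auto
    next
      case 2
      have gs: "geo_step C \<sigma> u (x + r *\<^sub>R u + ivec (w m)) (x + r *\<^sub>R u + ivec (w (Suc m)))"
        using \<open>Suc m < n\<close> straightened.step[OF straightened_axioms, of m] 2 by simp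
      have "w (Suc m) = w k \<or> w (Suc m) = w'"
      proof (cases "w m = w k")
        case True
        then have "at_exit u i (x + r *\<^sub>R u + ivec (w m)) c"
          using at_exit_add_ivec[OF r(3)] by (simp add: c_def)
        from geo_step_exit[OF fp this gs]
        have "ivec (w (Suc m)) = ivec (w m) \<or>
            ivec (w (Suc m)) = ivec (w m + (exit_perm C \<sigma> u i c - c - exit_vec u i))"
          by (auto simp: ivec_add add.assoc)
        then have "w (Suc m) = w m \<or> w (Suc m) = w m + (exit_perm C \<sigma> u i c - c - exit_vec u i)"
          using ivec_inj by blast
        then show ?thesis
          using True by (auto simp: w'_def c_def algebra_simps)
      next
        case False
        then have w': "w m = w'" "c + exit_vec u i \<notin> C"
          using IH(1) inside by auto
        have "N + w m = exit_perm C \<sigma> u i c - exit_vec u i"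
          using w'(1) by (simp add: w'_def)
        then have "at_exit u i (x + r *\<^sub>R u + ivec (w m)) (exit_perm C \<sigma> u i c - exit_vec u i)"
          using at_exit_add_ivec[OF r(3), of "w m"] by metis
        from geo_step_entry[OF fp c w'(2) this gs]
        have "w (Suc m) = w m"
          using ivec_inj by simp
        then show ?thesis
          using w' by simp
      qed
      then show ?thesis
        using 2 by auto
    qed
  qed
  have "w l = w'"
    using after[OF l r(2) order_refl] inv[OF st(2)] by blast
  then show ?thesis
    using cross by (simp add: w'_def c_def N_def)
qed

text \<open>At a piece boundary several indices qualify, so the facts about offsets are proved for
  arbitrary admissible indices.\<close>

definition piece :: "real \<Rightarrow> nat" where
  "piece t = (SOME k. k < n \<and> T k \<le> t \<and> t \<le> T (Suc k))"

lemma piece: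
  assumes "0 \<le> t" "t \<le> T n"
  shows "piece t < n" "T (piece t) \<le> t" "t \<le> T (Suc (piece t))"
proof -
  have ex: "t \<le> T (Suc (n - 1))"
    using assms n_pos by simp
  define k where "k = (LEAST k. t \<le> T (Suc k))"
  have k: "t \<le> T (Suc k)" "k \<le> n - 1"
    unfolding k_def using ex by (rule LeastI, rule Least_le)
  have "T k \<le> t"
  proof (cases k)
    case (Suc k')
    then have "\<not> t \<le> T (Suc k')"
      using not_less_Least[of k' "\<lambda>k. t \<le> T (Suc k)"] by (simp add: k_def)
    then show ?thesis
      using Suc by simp
  qed (use assms T_0 in simp)
  then have "\<exists>k. k < n \<and> T k \<le> t \<and> t \<le> T (Suc k)"
    using k n_pos by (intro exI[of _ k]) auto
  from someI_ex[OF this] show "piece t < n" "T (piece t) \<le> t" "t \<le> T (Suc (piece t))"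
    unfolding piece_def by auto
qed

text \<open>If the order of the indices is opposite to that of the times, then both times coincide,
  and the roles can be exchanged.\<close>

lemma piece_eqI:
  assumes "k < n" "T k \<le> s" "s \<le> T (Suc k)" "l < n" "T l \<le> t" "t \<le> T (Suc l)"
    and g: "generic (x + s *\<^sub>R u)" "generic (x + t *\<^sub>R u)" "fl (x + t *\<^sub>R u) = fl (x + s *\<^sub>R u)"
  shows "w l = w k"
proof -
  have *: "w l = w k" if kl: "k < n" "T k \<le> s" "s \<le> T (Suc k)" "l < n" "T l \<le> t" "t \<le> T (Suc l)"
    and g: "generic (x + s *\<^sub>R u)" "generic (x + t *\<^sub>R u)" "fl (x + t *\<^sub>R u) = fl (x + s *\<^sub>R u)"
    and st: "s \<le> t" for k l s t
  proof (cases "k \<le> l")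
    case True
    show ?thesis
      by (rule same_offset[OF kl st True g])
  next
    case False
    then have "T (Suc l) \<le> T k"
      using kl by (intro T_mono) auto
    then have "t \<le> s"
      using kl by linarith
    moreover have "l \<le> k"
      using False by simp
    ultimately show ?thesis
      using same_offset[OF kl(4-6,1-3) _ _ g(2,1) g(3)[symmetric]] by simp
  qed
  show ?thesis
  proof (cases "s \<le> t")
    case True
    then show ?thesis
      using *[OF assms] by simp
  next
    case False
    then have "t \<le> s" by simp
    from *[OF assms(4-6,1-3) g(2,1) g(3)[symmetric] this] show ?thesis
      by simp
  qed
qed

lemma crossing_piece:
  assumes "k < n" "T k \<le> s" "s \<le> T (Suc k)" "l < n" "T l \<le> t" "t \<le> T (Suc l)"
    and g: "generic (x + s *\<^sub>R u)" "generic (x + t *\<^sub>R u)" and st: "s \<le> t"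
    and cross: "fl (x + t *\<^sub>R u) = fl (x + s *\<^sub>R u) + exit_vec u i"
  shows "fl (x + t *\<^sub>R u) + w l = exit_perm C \<sigma> u i (fl (x + s *\<^sub>R u) + w k)"
proof (cases "k \<le> l")
  case True
  show ?thesis
    by (rule crossing_offset[OF assms(1-6) st True g cross])
next
  case False
  then have "T (Suc l) \<le> T k"
    using assms by (intro T_mono) auto
  then have "t = s"
    using assms by linarith
  then have "exit_vec u i = 0"
    using cross by simp
  then have "exit_vec u i $ i = 0"
    by simp
  then show ?thesis
    by (simp add: exit_vec_def split: if_splits)
qed

end

section \<open>Visiting frequency\<close>

definition (in straightened) label :: "real \<Rightarrow> int^3" where
  "label t = fl (x + t *\<^sub>R u) + w (piece t)"

lemma (in straightened) trajectory_label:
  assumes "cell_flow C (exit_perm C \<sigma> u) u"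
  shows "cell_flow.trajectory C (exit_perm C \<sigma> u) u x label 0 (T n)"
proof -
  interpret cell_flow C "exit_perm C \<sigma> u" u
    by (rule assms)
  show ?thesis
    unfolding trajectory_def
  proof (intro conjI allI impI)
    fix s assume "0 \<le> s \<and> s \<le> T n \<and> generic (x + s *\<^sub>R u)"
    then show "label s \<in> C"
      using label_in_C[OF piece, of s] by (simp add: label_def)
  next
    fix s t
    assume st: "0 \<le> s \<and> s \<le> t \<and> t \<le> T n \<and> generic (x + s *\<^sub>R u) \<and> generic (x + t *\<^sub>R u)"
    have ps: "piece s < n" "T (piece s) \<le> s" "s \<le> T (Suc (piece s))"
      using piece[of s] st by simp_all
    have pt: "piece t < n" "T (piece t) \<le> t" "t \<le> T (Suc (piece t))"
      using piece[of t] st by simp_all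
    show "label t = label s" if "fl (x + t *\<^sub>R u) = fl (x + s *\<^sub>R u)"
      using piece_eqI[OF ps pt _ _ that] st that by (simp add: label_def)
    show "label t = exit_perm C \<sigma> u i (label s)"
      if "fl (x + t *\<^sub>R u) = fl (x + s *\<^sub>R u) + exit_vec u i" for i
      using crossing_piece[OF ps pt _ _ _ that] st by (simp add: label_def)
  qed
qed

text \<open>At unit speed the line stays in the ball, hence in one cell, where the offset is
  constant even across piece boundaries.\<close>

lemma (in straightened) visit_interval:
  assumes u: "norm u = 1" and s: "0 \<le> s" "s \<le> T n" and t: "0 \<le> t" "t \<le> T n"
    and ball: "\<And>y. dist (x + s *\<^sub>R u + ivec (w (piece s))) y < d \<Longrightarrow> y \<in> G \<and> generic y \<and> fl y = g"
    and st: "\<bar>t - s\<bar> < d"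
  shows "x + t *\<^sub>R u + ivec (w (piece t)) \<in> G"
proof -
  have "x + s *\<^sub>R u + ivec (w (piece s)) - (x + t *\<^sub>R u + ivec (w (piece s))) = (s - t) *\<^sub>R u"
    by (simp add: algebra_simps)
  then have "dist (x + s *\<^sub>R u + ivec (w (piece s))) (x + t *\<^sub>R u + ivec (w (piece s))) = \<bar>t - s\<bar>"
    using u by (simp only: dist_norm norm_scaleR) simp
  then have y: "x + t *\<^sub>R u + ivec (w (piece s)) \<in> G \<and> generic (x + t *\<^sub>R u) \<and>
      fl (x + t *\<^sub>R u) + w (piece s) = g"
    using ball[of "x + t *\<^sub>R u + ivec (w (piece s))"] st by simp
  have y': "generic (x + s *\<^sub>R u) \<and> fl (x + s *\<^sub>R u) + w (piece s) = g"
    using ball[of "x + s *\<^sub>R u + ivec (w (piece s))"] st by simp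
  have "fl (x + t *\<^sub>R u) = fl (x + s *\<^sub>R u)"
    using y y' by (metis add_right_cancel)
  then have "w (piece t) = w (piece s)"
    using piece_eqI[OF piece[OF s] piece[OF t]] y y' by blast
  then show ?thesis
    using y by simp
qed

section \<open>Measure and topology of the visiting times\<close>

lemma measure_ge_disjoint_intervals:
  fixes B d :: real
  assumes V: "V \<in> fmeasurable lborel" and B: "B \<ge> 0" and d: "d \<ge> 0"
    and I: "\<And>j. j < N \<Longrightarrow> \<exists>s. {s - d<..<s + d} \<subseteq> V \<and> real j * B \<le> s - d \<and> s + d \<le> real (Suc j) * B"
  shows "real N * (2 * d) \<le> measure lborel V"
proof -
  obtain s where s: "\<And>j. j < N \<Longrightarrow> {s j - d<..<s j + d} \<subseteq> V"
    "\<And>j. j < N \<Longrightarrow> real j * B \<le> s j - d" "\<And>j. j < N \<Longrightarrow> s j + d \<le> real (Suc j) * B"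
    using I by metis
  have lt: "{s i - d<..<s i + d} \<inter> {s j - d<..<s j + d} = {}" if "i < j" "j < N" for i j
  proof -
    have "real (Suc i) * B \<le> real j * B"
      using that(1) B by (intro mult_right_mono) simp_all
    then have "s i + d \<le> s j - d"
      using s(3)[of i] s(2)[of j] that by simp
    then show ?thesis
      by auto
  qed
  have disj: "pairwise (\<lambda>i j. disjnt {s i - d<..<s i + d} {s j - d<..<s j + d}) {..<N}"
  proof (rule pairwiseI)
    fix i j assume "i \<in> {..<N}" "j \<in> {..<N}" "i \<noteq> j"
    then show "disjnt {s i - d<..<s i + d} {s j - d<..<s j + d}"
      using lt[of i j] lt[of j i] unfolding disjnt_def by (metis Int_commute lessThan_iff nat_neq_iff)
  qed
  have "real N * (2 * d) = (\<Sum>j<N. measure lborel {s j - d<..<s j + d})"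
    using d by simp
  also have "\<dots> = measure lborel (\<Union>j<N. {s j - d<..<s j + d})"
    using disj d by (intro measure_UNION'[symmetric]) (auto simp: fmeasurable_def)
  also have "\<dots> \<le> measure lborel V"
    using s(1) V by (intro measure_mono_fmeasurable) auto
  finally show ?thesis .
qed

lemma atomic_cube_eq_cbox: "atomic_cube c = cbox (ivec c) (ivec c + 1)"
  by (auto simp: atomic_cube_def mem_box_cart)

lemma borel_relatively_open:
  assumes "finite C" "openin (top_of_set (region C)) G"
  shows "G \<in> sets borel"
proof -
  have "closed (region C)"
    using assms(1) unfolding region_def by (intro closed_Union) (auto simp: atomic_cube_eq_cbox)
  moreover obtain O' where "open O'" "G = region C \<inter> O'"
    using assms(2) by (auto simp: openin_open)
  ultimately show ?thesis
    by auto
qed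

text \<open>\<open>G\<close> is only relatively open, but a cube is the closure of its interior, so
  an open set that meets the cube also meets its open cell.\<close>

lemma manifold_open_contains_ball:
  assumes "manifold_open C \<sigma> G" "G \<noteq> {}"
  obtains g y d where "g \<in> C" "d > 0"
    "\<And>y'. dist y y' < d \<Longrightarrow> y' \<in> G \<and> generic y' \<and> fl y' = g"
proof -
  obtain O' where O': "open O'" "G = region C \<inter> O'"
    using assms(1) by (auto simp: manifold_open_def openin_open)
  obtain p g where g: "g \<in> C" "p \<in> atomic_cube g" "p \<in> O'"
    using assms(2) O'(2) by (auto simp: region_def)
  have "(ivec g + (\<chi> i. 1 / 2)) \<in> box (ivec g) (ivec g + 1)"
    by (simp add: mem_box_cart)
  then have "closure (box (ivec g) (ivec g + 1)) = atomic_cube g"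
    unfolding atomic_cube_eq_cbox by (intro closure_box) blast
  then have "O' \<inter> box (ivec g) (ivec g + 1) \<noteq> {}"
    using open_Int_closure_eq_empty[OF O'(1)] g(2,3) by blast
  then obtain y where y: "y \<in> O' \<inter> box (ivec g) (ivec g + 1)"
    by blast
  moreover have "open (O' \<inter> box (ivec g) (ivec g + 1))"
    using O'(1) by (intro open_Int open_box)
  ultimately obtain d where d: "d > 0" "ball y d \<subseteq> O' \<inter> box (ivec g) (ivec g + 1)"
    using open_contains_ball by blast
  show thesis
  proof (rule that[OF g(1) d(1)])
    fix y' assume "dist y y' < d"
    then have y': "y' \<in> O'" "y' \<in> box (ivec g) (ivec g + 1)"
      using d(2) by auto
    then have "y' \<in> atomic_cube g"
      using box_subset_cbox unfolding atomic_cube_eq_cbox by blast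
    then show "y' \<in> G \<and> generic y' \<and> fl y' = g"
      using y' O'(2) g(1) unfolding cell_eq_box[symmetric] by (auto simp: region_def)
  qed
qed

lemma visit_times_borel:
  fixes x u :: "real^3"
  assumes "G \<in> sets borel"
  shows "{t \<in> {a..b}. x + t *\<^sub>R u \<in> G} \<in> sets borel"
proof -
  have "(\<lambda>t. x + t *\<^sub>R u) \<in> borel_measurable borel"
    by (intro borel_measurable_continuous_onI continuous_intros)
  from measurable_sets_borel[OF this assms]
  have "{a..b} \<inter> (\<lambda>t. x + t *\<^sub>R u) -` G \<in> sets borel"
    by simp
  moreover have "{t \<in> {a..b}. x + t *\<^sub>R u \<in> G} = {a..b} \<inter> (\<lambda>t. x + t *\<^sub>R u) -` G"
    by auto
  ultimately show ?thesis
    by simp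
qed

text \<open>Gluing translations are integral, so by induction each piece starts at an integer
  translate of a point of one line. Translation invariance of Lebesgue measure moves the clock of
  piece \<open>k\<close> to \<open>T k\<close>.\<close>

lemma geodesic_straightened:
  assumes G: "G \<in> sets borel" and fp: "face_pairing C \<sigma>" and u: "\<And>i. unit_dir v $ i \<noteq> 0" and L: "geodesic_segment C \<sigma> v L"
  obtains x w T where "straightened C \<sigma> (unit_dir v) x T w (length L)" "T (length L) = seg_length L"
    "visit_measure v G L = (\<Sum>k<length L.
      measure lborel {t \<in> {T k..T (Suc k)}. x + t *\<^sub>R unit_dir v + ivec (w k) \<in> G})"
proof -
  define u' where "u' = unit_dir v"
  define x where "x = fst (L ! 0)"
  define T where "T = (\<lambda>k. \<Sum>j<k. snd (L ! j))"
  have piece: "0 \<le> snd (L ! k)"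
    "\<And>s. 0 \<le> s \<Longrightarrow> s \<le> snd (L ! k) \<Longrightarrow> fst (L ! k) + s *\<^sub>R u' \<in> region C" if "k < length L" for k
    using L nth_mem[OF that] by (fastforce simp: geodesic_segment_def u'_def)+
  have gs: "geo_step C \<sigma> u' (fst (L ! k) + snd (L ! k) *\<^sub>R u') (fst (L ! Suc k))"
    if "Suc k < length L" for k
    using L that by (simp add: geodesic_segment_def u'_def)
  have T: "T 0 = 0" "\<And>k. T (Suc k) = T k + snd (L ! k)"
    by (simp_all add: T_def)
  have "\<exists>z. fst (L ! k) = x + T k *\<^sub>R u' + ivec z" if "k < length L" for k
    using that
  proof (induction k)
    case 0
    then show ?case
      by (intro exI[of _ 0]) (simp add: x_def T)
  next
    case (Suc k)
    then obtain z where z: "fst (L ! k) = x + T k *\<^sub>R u' + ivec z"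
      by auto
    have "\<exists>z'. p = q + ivec z'" if "geo_step C \<sigma> u' q p" for p q
      using that unfolding geo_step_def shift_def
      by (metis add.right_neutral diff_conv_add_uminus ivec_0 ivec_uminus)
    from this[OF gs[OF Suc.prems]] obtain z' where
      "fst (L ! Suc k) = fst (L ! k) + snd (L ! k) *\<^sub>R u' + ivec z'"
      by blast
    then show ?case
      by (intro exI[of _ "z + z'"]) (simp add: z T ivec_add algebra_simps)
  qed
  then obtain w where w: "\<And>k. k < length L \<Longrightarrow> fst (L ! k) = x + T k *\<^sub>R u' + ivec (w k)"
    by metis
  have pos: "fst (L ! k) + (t - T k) *\<^sub>R u' = x + t *\<^sub>R u' + ivec (w k)" if "k < length L" for k t
    by (simp add: w[OF that] algebra_simps)
  show thesis
  proof (rule that[of x T w])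
    show "straightened C \<sigma> (unit_dir v) x T w (length L)"
      unfolding u'_def[symmetric]
    proof
      show "face_pairing C \<sigma>" "u' $ i \<noteq> 0" "length L > 0" "T 0 = 0" for i
        using fp u L by (auto simp: geodesic_segment_def u'_def T_def)
      show "T k \<le> T (Suc k)" if "k < length L" for k
        using piece(1)[OF that] by (simp add: T)
      show "x + t *\<^sub>R u' + ivec (w k) \<in> region C"
        if "k < length L" "T k \<le> t" "t \<le> T (Suc k)" for k t
        using piece(2)[OF that(1), of "t - T k"] that(2,3) pos[OF that(1), of t] by (simp add: T)
      show "geo_step C \<sigma> u' (x + T (Suc k) *\<^sub>R u' + ivec (w k))
          (x + T (Suc k) *\<^sub>R u' + ivec (w (Suc k)))" if "Suc k < length L" for k
        using gs[OF that] pos[of k "T (Suc k)"] w[OF that] that by (simp add: T(2))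
    qed
    show "T (length L) = seg_length L"
      by (simp add: T_def seg_length_def sum_list_sum_nth atLeast0LessThan)
    have "measure lborel {s \<in> {0..snd (L ! k)}. fst (L ! k) + s *\<^sub>R u' \<in> G} =
        measure lborel {t \<in> {T k..T (Suc k)}. x + t *\<^sub>R u' + ivec (w k) \<in> G}"
      if "k < length L" for k
    proof -
      define S where "S = {t \<in> {T k..T (Suc k)}. x + t *\<^sub>R u' + ivec (w k) \<in> G}"
      have "S = {t \<in> {T k..T (Suc k)}. x + ivec (w k) + t *\<^sub>R u' \<in> G}"
        by (simp add: S_def algebra_simps)
      then have S: "S \<in> sets borel"
        using visit_times_borel[OF G] by simp
      have "fst (L ! k) + s *\<^sub>R u' = x + (T k + s) *\<^sub>R u' + ivec (w k)" for s
        using pos[OF that, of "T k + s"] by simp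
      then have "{s \<in> {0..snd (L ! k)}. fst (L ! k) + s *\<^sub>R u' \<in> G} = (+) (T k) -` S"
        by (auto simp: S_def T(2))
      then have "measure lborel {s \<in> {0..snd (L ! k)}. fst (L ! k) + s *\<^sub>R u' \<in> G} =
          measure (distr lborel borel ((+) (T k))) S"
        using S by (simp add: measure_distr)
      then show ?thesis
        by (simp add: lborel_distr_plus S_def)
    qed
    then show "visit_measure v G L = (\<Sum>k<length L.
        measure lborel {t \<in> {T k..T (Suc k)}. x + t *\<^sub>R unit_dir v + ivec (w k) \<in> G})"
      by (simp add: visit_measure_def sum_list_sum_nth atLeast0LessThan case_prod_beta u'_def)
  qed
qed

lemma kronecker_unit_dir:
  assumes "kronecker_dir \<alpha>1 \<alpha>2"
    and z: "(\<Sum>i\<in>UNIV. of_int (z $ i) * unit_dir (vector [\<alpha>1, \<alpha>2, 1]) $ i) = 0"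
  shows "z = 0"
proof -
  define v :: "real^3" where "v = vector [\<alpha>1, \<alpha>2, 1]"
  have "v $ 3 = 1"
    by (simp add: v_def)
  then have "v \<noteq> 0"
    by auto
  have "(\<Sum>i\<in>UNIV. of_int (z $ i) * unit_dir v $ i) = (\<Sum>i\<in>UNIV. of_int (z $ i) * v $ i) / norm v"
    by (simp add: unit_dir_def sum_divide_distrib)
  then have "(\<Sum>i\<in>UNIV. of_int (z $ i) * v $ i) = 0"
    using z \<open>v \<noteq> 0\<close> by (simp add: v_def)
  then have "of_int (z $ 1) * \<alpha>1 + of_int (z $ 2) * \<alpha>2 + of_int (z $ 3) = 0"
    by (simp add: sum_3 v_def)
  then have "of_rat (of_int (z $ 1)) * \<alpha>1 + of_rat (of_int (z $ 2)) * \<alpha>2 + of_rat (of_int (z $ 3)) = 0"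
    by simp
  then have "of_int (z $ 1) = (0::rat) \<and> of_int (z $ 2) = (0::rat) \<and> of_int (z $ 3) = (0::rat)"
    using assms(1) unfolding kronecker_dir_def by blast
  then show ?thesis
    by (simp add: vec_eq_iff forall_3)
qed

theorem theorem4:
  fixes C :: "(int^3) set" and \<sigma> :: "3 \<Rightarrow> int^3 \<Rightarrow> int^3"
    and \<alpha>1 \<alpha>2 :: real and G :: "(real^3) set"
  assumes "polycube_region C"
    and "face_pairing C \<sigma>"
    and "kronecker_dir \<alpha>1 \<alpha>2"
    and "manifold_open C \<sigma> G"
    and "G \<noteq> {}"
  shows "\<exists>F > 0. \<exists>c > 0. \<forall>L.
           geodesic_segment C \<sigma> (vector [\<alpha>1, \<alpha>2, 1]) L \<and> seg_length L \<ge> c \<longrightarrow>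
           visit_measure (vector [\<alpha>1, \<alpha>2, 1]) G L \<ge> F * seg_length L"
proof -
  define v :: "real^3" where "v = vector [\<alpha>1, \<alpha>2, 1]"
  define u where "u = unit_dir v"
  have "v $ 3 = 1"
    by (simp add: v_def)
  then have "v \<noteq> 0"
    by auto
  then have norm_u: "norm u = 1"
    by (simp add: u_def unit_dir_def)
  interpret cell_flow C "exit_perm C \<sigma> u" u
  proof
    show "finite C"
      using assms(1) by (simp add: polycube_region_def)
    show "bij_betw (exit_perm C \<sigma> u i) C C" for i
      by (rule bij_exit_perm[OF assms(2)])
    show "D = C" if "D \<subseteq> C" "D \<noteq> {}" "\<And>i. exit_perm C \<sigma> u i ` D = D" for D
      by (rule exit_perm_transitive[OF assms(1,2) that])
    show "z = 0" if "(\<Sum>i\<in>UNIV. of_int (z $ i) * u $ i) = 0" for z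
      by (rule kronecker_unit_dir[OF assms(3)]) (use that in \<open>simp add: u_def v_def\<close>)
  qed
  obtain g y d' where g: "g \<in> C" and "d' > 0"
    and ball: "\<And>y'. dist y y' < d' \<Longrightarrow> y' \<in> G \<and> generic y' \<and> fl y' = g"
    by (rule manifold_open_contains_ball[OF assms(4,5)]) (rule that; assumption)
  \<comment> \<open>Half the radius, so that a point within \<open>d\<close> of \<open>y\<close> has
    its whole ball of radius \<open>d\<close> inside \<open>G\<close>.\<close>
  define d where "d = d' / 2"
  have d: "d > 0" "d' = 2 * d"
    using \<open>d' > 0\<close> by (simp_all add: d_def)
  define U where "U = ball (y - ivec g) d"
  have U: "open U" "U \<noteq> {}"
    using d(1) by (simp_all add: U_def)
  have "U \<subseteq> box 0 1"
  proof
    fix p assume "p \<in> U"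
    then have "dist y (p + ivec g) < d'"
      using d by (simp add: U_def dist_norm algebra_simps)
    from ball[OF this] have "generic p \<and> fl p = 0"
      by simp
    then show "p \<in> box 0 1"
      using cell_eq_box[of 0] by auto
  qed
  from uniform_visits[OF g U this] obtain T0 where T0: "T0 > 0"
    "\<And>x k a. trajectory x k a (a + T0) \<Longrightarrow>
      \<exists>s. a \<le> s \<and> s \<le> a + T0 \<and> generic (x + s *\<^sub>R u) \<and> k s = g \<and>
        x + s *\<^sub>R u - ivec (fl (x + s *\<^sub>R u)) \<in> U"
    by blast
  \<comment> \<open>A block of length \<open>B\<close> holds a search window of length
    \<open>T0\<close> with a margin \<open>d\<close> at each end, so visits of duration
    \<open>2 * d\<close> in different blocks are disjoint.\<close>
  define B where "B = T0 + 2 * d"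
  have B: "B > 0"
    using T0(1) d(1) by (simp add: B_def)
  have G: "G \<in> sets borel"
    using borel_relatively_open[OF finite_C] assms(4) by (simp add: manifold_open_def)
  \<comment> \<open>The \<open>N\<close> complete blocks give visiting time at least
    \<open>2 * d * N\<close>; length at least \<open>2 * B\<close> ensures that \<open>N\<close> is
    at least half of \<open>l / B\<close>, whence the rate \<open>d / B\<close>.\<close>
  have main: "visit_measure v G L \<ge> d / B * seg_length L"
    if L: "geodesic_segment C \<sigma> v L" and len: "seg_length L \<ge> 2 * B" for L
  proof -
    obtain x w T where str: "straightened C \<sigma> u x T w (length L)"
      and Tn: "T (length L) = seg_length L"
      and vm: "visit_measure v G L = (\<Sum>k<length L.
        measure lborel {t \<in> {T k..T (Suc k)}. x + t *\<^sub>R u + ivec (w k) \<in> G})"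
      by (rule geodesic_straightened[OF G assms(2) u_nonzero[unfolded u_def] L, folded u_def])
        (rule that; assumption)
    interpret straightened C \<sigma> u x T w "length L"
      by (rule str)
    define V where "V k = {t \<in> {T k..T (Suc k)}. x + t *\<^sub>R u + ivec (w k) \<in> G}" for k
    have V_sets: "V k \<in> sets borel" for k
      using visit_times_borel[OF G, of "T k" "T (Suc k)" "x + ivec (w k)" u]
      by (simp add: V_def algebra_simps)
    have "V k \<in> fmeasurable lborel" for k
    proof (rule fmeasurableI2)
      show "{T k..T (Suc k)} \<in> fmeasurable lborel"
        by (simp add: fmeasurable_def emeasure_lborel_Icc_eq)
      show "V k \<subseteq> {T k..T (Suc k)}" "V k \<in> sets lborel"
        using V_sets by (auto simp: V_def)
    qed
    then have V: "(\<Union>k<length L. V k) \<in> fmeasurable lborel"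
      by (intro fmeasurable.finite_UN) auto
    define l where "l = seg_length L"
    define N where "N = nat \<lfloor>l / B\<rfloor>"
    have "l / B \<ge> 2"
      using len B by (simp add: l_def field_simps)
    then have N: "real N \<le> l / B" "l / B < real N + 1"
      unfolding N_def by linarith+
    have traj: "trajectory x label 0 l"
      using trajectory_label[OF cell_flow_axioms] by (simp add: Tn l_def)
    have "\<exists>s. {s - d<..<s + d} \<subseteq> (\<Union>k<length L. V k) \<and> real j * B \<le> s - d \<and> s + d \<le> real (Suc j) * B"
      if "j < N" for j
    proof -
      define a where "a = real j * B + d"
      have "real (Suc j) * B \<le> real N * B"
        using that B by (intro mult_right_mono) simp_all
      also have "\<dots> \<le> l"
        using N(1) B by (simp add: field_simps)
      finally have end_le: "real (Suc j) * B \<le> l" .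
      have "0 \<le> a - d"
        using B by (simp add: a_def)
      moreover have "a + T0 + d = real (Suc j) * B"
        by (simp add: a_def B_def algebra_simps)
      ultimately have a: "0 \<le> a - d" "a + T0 + d = real (Suc j) * B"
        by simp_all
      have "trajectory (x + 0 *\<^sub>R u + ivec 0) (\<lambda>s. label (s + 0)) a (a + T0)"
        by (rule trajectory_shift[OF traj]) (use a end_le d in auto)
      then have "trajectory x label a (a + T0)"
        by simp
      from T0(2)[OF this] obtain s where s: "a \<le> s" "s \<le> a + T0" "label s = g"
        "x + s *\<^sub>R u - ivec (fl (x + s *\<^sub>R u)) \<in> U"
        by blast
      have eq: "x + s *\<^sub>R u + ivec (w (piece s)) =
          x + s *\<^sub>R u - ivec (fl (x + s *\<^sub>R u)) + ivec g"
        using s(3) by (auto simp: label_def ivec_add)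
      have "dist y (x + s *\<^sub>R u + ivec (w (piece s))) < d"
        using s(4) unfolding eq U_def by (simp add: dist_norm algebra_simps)
      then have near: "y' \<in> G \<and> generic y' \<and> fl y' = g"
        if "dist (x + s *\<^sub>R u + ivec (w (piece s))) y' < d" for y'
        using that dist_triangle_less_add[of y "x + s *\<^sub>R u + ivec (w (piece s))" d y' d] d(2)
        by (intro ball) (simp add: dist_commute)
      have "t \<in> (\<Union>k<length L. V k)" if "s - d < t" "t < s + d" for t
      proof -
        have t: "0 \<le> t" "t \<le> T (length L)" and s': "0 \<le> s" "s \<le> T (length L)"
          using that s(1,2) a end_le d(1) by (simp_all add: Tn l_def[symmetric])
        have "x + t *\<^sub>R u + ivec (w (piece t)) \<in> G"
          by (rule visit_interval[OF norm_u s' t near]) (use that in auto)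
        then show ?thesis
          using piece[OF t] by (auto simp: V_def)
      qed
      then show ?thesis
        using s(1,2) a by (intro exI[of _ s]) (auto simp: a_def)
    qed
    then have "real N * (2 * d) \<le> measure lborel (\<Union>k<length L. V k)"
      using B d(1) by (intro measure_ge_disjoint_intervals[OF V, of B]) auto
    also have "\<dots> \<le> (\<Sum>k<length L. measure lborel (V k))"
      using V_sets by (intro measure_UNION_le) auto
    also have "\<dots> = visit_measure v G L"
      by (simp add: vm V_def)
    finally have "real N * (2 * d) \<le> visit_measure v G L" .
    moreover have "l / B \<le> 2 * real N"
      using N \<open>l / B \<ge> 2\<close> by linarith
    then have "d * (l / B) \<le> d * (2 * real N)"
      using d(1) by (intro mult_left_mono) simp_all
    ultimately show ?thesis
      by (simp add: l_def algebra_simps)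
  qed
  show ?thesis
    using B d(1) main unfolding v_def by (intro exI[of _ "d / B"] conjI exI[of _ "2 * B"]) auto
qed

end
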